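(* Let $g_t$ be an extrinsic geometric flow $\partial_tg_t=\sum_{j=0}^{n-1}f_j\,\hat b_j^{\,t}$ on an $(n+1)$-dimensional manifold $M$ with a codimension-one transversely oriented foliation $\mathcal F$, and let $\tau_i^t$ denote the $i$-th power sum of the principal curvatures of $\mathcal F$ with respect to $g_t$. If $f_1=C=\mathrm{const}$ and $f_j=0$ for all $j\ne1$, then for all $i$ and $t$ $$\tau_i^t=\tau_i^0\circ\phi_{-t},$$ where $\phi_t(p,s)=(\psi_t(p),t+s)$ is the flow of $\partial_t+\frac C2N$ on $M\times\mathbb R$, $\psi_t$ is the flow of $\frac C2N$ on $M$, and $\tau_i^t$ is regarded as a function on $M\times\{t\}$ (that is, $\tau_i^t(p)=\tau_i^0(\psi_{-t}(p))$). In particular, if $\tau_i^0=\mathrm{const}$ for some $i$, then $\tau_i^t=\mathrm{const}$ for all $t$.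
   Context: Let $(M^{n+1},g)$ be a Riemannian manifold with a codimension-one transversely oriented foliation $\mathcal F$, Levi-Civita connection $\nabla$, and positively oriented unit normal field $N$ to $\mathcal F$ (unchanged along the flow). The Weingarten operator is $A:X\in T\mathcal F\mapsto-\nabla_XN$, extended by $A(N)=0$. For a vector $X$, $\hat X$ is its $\mathcal F$-component, $\hat g(X,Y)=g(\hat X,\hat Y)$; $\hat b_0=\hat g$ and $\hat b_j(X,Y)=\hat g(A^jX,Y)$ for $j\ge1$; $\hat b_j^{\,t}$ is computed from $g_t$. The principal curvatures $k_1,\dots,k_n$ are the eigenvalues of $A|_{T\mathcal F}$, and $\tau_i=\sum_l k_l^i$.
   Formalization: The flow of (C/2)N need not be complete: the identity is stated at all (p,t) where ψ_{-t}(p) is defined, and the "in particular" for those t for which ψ_{-t} is defined on all of M (it fails otherwise); n ≥ 2 is assumed so that f_1 occurs in the sum. *)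

theory Defs
  imports "HOL-Analysis.Analysis"
begin

text \<open>Derivatives are taken within \<open>S\<close>, so that on a product of an interval with an open set
  the derivative at an endpoint of the interval is the one-sided one.\<close>

primrec Ck_on :: "nat \<Rightarrow> 'a::real_normed_vector set \<Rightarrow> ('a \<Rightarrow> 'b::real_normed_vector) \<Rightarrow> bool" where
  "Ck_on 0 S f \<longleftrightarrow> continuous_on S f"
| "Ck_on (Suc k) S f \<longleftrightarrow>
    (\<exists>f'. (\<forall>x\<in>S. (f has_derivative f' x) (at x within S)) \<and> (\<forall>v. Ck_on k S (\<lambda>x. f' x v)))"

definition smooth_on :: "'a::real_normed_vector set \<Rightarrow> ('a \<Rightarrow> 'b::real_normed_vector) \<Rightarrow> bool" where
  "smooth_on S f \<longleftrightarrow> (\<forall>k. Ck_on k S f)"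

text \<open>The manifold is the whole type \<open>'m\<close>, whose class provides the Hausdorff property and second
  countability. An atlas need not be maximal (but may be).\<close>

type_synonym ('m, 'b) chart = "'m set \<times> ('m \<Rightarrow> 'b)"

abbreviation cdom :: "('m, 'b) chart \<Rightarrow> 'm set" where
  "cdom c \<equiv> fst c"

abbreviation coord :: "('m, 'b) chart \<Rightarrow> 'm \<Rightarrow> 'b" where
  "coord c \<equiv> snd c"

definition chart_inv :: "('m, 'b) chart \<Rightarrow> 'b \<Rightarrow> 'm" where
  "chart_inv c = inv_into (cdom c) (coord c)"

definition is_chart :: "('m::topological_space, 'b::topological_space) chart \<Rightarrow> bool" where
  "is_chart c \<longleftrightarrow> open (cdom c) \<and> open (coord c ` cdom c) \<and>
     homeomorphism (cdom c) (coord c ` cdom c) (coord c) (chart_inv c)"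

definition trans_map :: "('m, 'b) chart \<Rightarrow> ('m, 'b) chart \<Rightarrow> 'b \<Rightarrow> 'b" where
  "trans_map c d = coord d \<circ> chart_inv c"

definition smooth_atlas ::
  "('m::{t2_space,second_countable_topology}, 'b::euclidean_space) chart set \<Rightarrow> bool" where
  "smooth_atlas \<A> \<longleftrightarrow> (\<forall>c\<in>\<A>. is_chart c) \<and> (\<Union>c\<in>\<A>. cdom c) = UNIV \<and>
     (\<forall>c\<in>\<A>. \<forall>d\<in>\<A>. smooth_on (coord c ` (cdom c \<inter> cdom d)) (trans_map c d))"

definition jac :: "('m, 'b::real_normed_vector) chart \<Rightarrow> ('m, 'b) chart \<Rightarrow> 'm \<Rightarrow> 'b \<Rightarrow> 'b" where
  "jac c d p = frechet_derivative (trans_map c d) (at (coord c p))"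

definition chart_deriv ::
  "('m, 'b::real_normed_vector) chart \<Rightarrow> ('m \<Rightarrow> 'a::real_normed_vector) \<Rightarrow> 'm \<Rightarrow> 'b \<Rightarrow> 'a" where
  "chart_deriv c h p u = frechet_derivative (\<lambda>x. h (chart_inv c x)) (at (coord c p)) u"

definition smooth_in_chart ::
  "('m, 'b::real_normed_vector) chart \<Rightarrow> ('m \<Rightarrow> 'a::real_normed_vector) \<Rightarrow> bool" where
  "smooth_in_chart c h \<longleftrightarrow> smooth_on (coord c ` cdom c) (\<lambda>x. h (chart_inv c x))"

text \<open>Vector fields, metrics and connections are families of components, one for each chart of the
  atlas, subject to the classical transformation laws. Components in \<open>c\<close> are relevant only at
  points of \<open>cdom c\<close>.\<close>

type_synonym ('m, 'b) vfield = "('m, 'b) chart \<Rightarrow> 'm \<Rightarrow> 'b"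
type_synonym ('m, 'b) metric_field = "('m, 'b) chart \<Rightarrow> 'm \<Rightarrow> 'b \<Rightarrow> 'b \<Rightarrow> real"
type_synonym ('m, 'b) conn = "('m, 'b) chart \<Rightarrow> 'm \<Rightarrow> 'b \<Rightarrow> 'b \<Rightarrow> 'b"

definition vector_field ::
  "('m, 'b::euclidean_space) chart set \<Rightarrow> ('m, 'b) vfield \<Rightarrow> bool" where
  "vector_field \<A> X \<longleftrightarrow> (\<forall>c\<in>\<A>. smooth_in_chart c (X c)) \<and>
     (\<forall>c\<in>\<A>. \<forall>d\<in>\<A>. \<forall>p\<in>cdom c \<inter> cdom d. X d p = jac c d p (X c p))"

definition riemannian_metric ::
  "('m, 'b::euclidean_space) chart set \<Rightarrow> ('m, 'b) metric_field \<Rightarrow> bool" where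
  "riemannian_metric \<A> g \<longleftrightarrow>
     (\<forall>c\<in>\<A>. \<forall>u v. smooth_in_chart c (\<lambda>p. g c p u v)) \<and>
     (\<forall>c\<in>\<A>. \<forall>p\<in>cdom c. bilinear (g c p) \<and> (\<forall>u v. g c p u v = g c p v u) \<and>
        (\<forall>u. u \<noteq> 0 \<longrightarrow> g c p u u > 0)) \<and>
     (\<forall>c\<in>\<A>. \<forall>d\<in>\<A>. \<forall>p\<in>cdom c \<inter> cdom d. \<forall>u v.
        g c p u v = g d p (jac c d p u) (jac c d p v))"

text \<open>An affine connection is given by its Christoffel maps, \<open>\<Gamma> c p u v\<close> being the covariant
  derivative in direction \<open>u\<close> of the field with constant \<open>c\<close>-components \<open>v\<close>. The last condition
  says exactly that covariant derivatives of vector fields transform as vectors.\<close>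

definition affine_connection ::
  "('m, 'b::euclidean_space) chart set \<Rightarrow> ('m, 'b) conn \<Rightarrow> bool" where
  "affine_connection \<A> \<Gamma> \<longleftrightarrow>
     (\<forall>c\<in>\<A>. \<forall>u v. smooth_in_chart c (\<lambda>p. \<Gamma> c p u v)) \<and>
     (\<forall>c\<in>\<A>. \<forall>p\<in>cdom c. bilinear (\<Gamma> c p)) \<and>
     (\<forall>c\<in>\<A>. \<forall>d\<in>\<A>. \<forall>p\<in>cdom c \<inter> cdom d. \<forall>u v.
        jac c d p (\<Gamma> c p u v) =
          chart_deriv c (\<lambda>q. jac c d q v) p u + \<Gamma> d p (jac c d p u) (jac c d p v))"

text \<open>Covariant derivative at \<open>p\<close>, in direction \<open>u\<close>, of the field on \<open>cdom c\<close> with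
  \<open>c\<close>-components \<open>Y\<close>.\<close>

definition cov_deriv ::
  "('m, 'b::euclidean_space) conn \<Rightarrow> ('m, 'b) chart \<Rightarrow> ('m \<Rightarrow> 'b) \<Rightarrow> 'm \<Rightarrow> 'b \<Rightarrow> 'b" where
  "cov_deriv \<Gamma> c Y p u = chart_deriv c Y p u + \<Gamma> c p u (Y p)"

definition lie_bracket ::
  "('m, 'b::euclidean_space) chart \<Rightarrow> ('m \<Rightarrow> 'b) \<Rightarrow> ('m \<Rightarrow> 'b) \<Rightarrow> 'm \<Rightarrow> 'b" where
  "lie_bracket c X Y p = chart_deriv c Y p (X p) - chart_deriv c X p (Y p)"

definition torsion_free ::
  "('m, 'b::euclidean_space) chart set \<Rightarrow> ('m, 'b) conn \<Rightarrow> bool" where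
  "torsion_free \<A> \<Gamma> \<longleftrightarrow>
     (\<forall>c\<in>\<A>. \<forall>X Y. smooth_in_chart c X \<longrightarrow> smooth_in_chart c Y \<longrightarrow>
        (\<forall>p\<in>cdom c. cov_deriv \<Gamma> c Y p (X p) - cov_deriv \<Gamma> c X p (Y p) = lie_bracket c X Y p))"

definition metric_compatible ::
  "('m, 'b::euclidean_space) chart set \<Rightarrow> ('m, 'b) metric_field \<Rightarrow> ('m, 'b) conn \<Rightarrow> bool" where
  "metric_compatible \<A> g \<Gamma> \<longleftrightarrow>
     (\<forall>c\<in>\<A>. \<forall>Y Z. smooth_in_chart c Y \<longrightarrow> smooth_in_chart c Z \<longrightarrow>
        (\<forall>p\<in>cdom c. \<forall>u. chart_deriv c (\<lambda>q. g c q (Y q) (Z q)) p u =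
           g c p (cov_deriv \<Gamma> c Y p u) (Z p) + g c p (Y p) (cov_deriv \<Gamma> c Z p u)))"

definition levi_civita ::
  "('m, 'b::euclidean_space) chart set \<Rightarrow> ('m, 'b) metric_field \<Rightarrow> ('m, 'b) conn \<Rightarrow> bool" where
  "levi_civita \<A> g \<Gamma> \<longleftrightarrow>
     affine_connection \<A> \<Gamma> \<and> torsion_free \<A> \<Gamma> \<and> metric_compatible \<A> g \<Gamma>"

text \<open>The foliation is given by its foliated charts, with values in \<open>'e \<times> real\<close>: the plaques are
  the level sets of the second coordinate, and changes of foliated charts act locally on this
  coordinate alone and increasingly. Requiring foliated charts to be members of \<open>\<A>\<close> is no
  restriction, as \<open>\<A>\<close> may be the maximal atlas.\<close>

definition transversely_oriented_foliation ::
  "('m::topological_space, 'e::euclidean_space \<times> real) chart set \<Rightarrow> ('m, 'e \<times> real) chart set \<Rightarrow> bool"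
  where
  "transversely_oriented_foliation \<A> \<F> \<longleftrightarrow> \<F> \<subseteq> \<A> \<and> (\<Union>c\<in>\<F>. cdom c) = UNIV \<and>
     (\<forall>d\<in>\<F>. \<forall>e\<in>\<F>. \<forall>p\<in>cdom d \<inter> cdom e. \<exists>W h. open W \<and> p \<in> W \<and> W \<subseteq> cdom d \<inter> cdom e \<and>
        (\<forall>q\<in>W. snd (coord e q) = h (snd (coord d q)) \<and>
           (\<exists>D>0. (h has_real_derivative D) (at (snd (coord d q))))))"

text \<open>Being annihilated by the differential of the transverse coordinate of one foliated chart around
  \<open>p\<close> or of all of them amounts to the same.\<close>

definition tangent_leaf ::
  "('m, 'e::euclidean_space \<times> real) chart set \<Rightarrow> ('m, 'e \<times> real) chart \<Rightarrow> 'm \<Rightarrow> ('e \<times> real) set" where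
  "tangent_leaf \<F> c p = {v. \<forall>e\<in>\<F>. p \<in> cdom e \<longrightarrow> snd (jac c e p v) = 0}"

definition oriented_unit_normal ::
  "('m, 'e::euclidean_space \<times> real) chart set \<Rightarrow> ('m, 'e \<times> real) chart set \<Rightarrow>
     ('m, 'e \<times> real) metric_field \<Rightarrow> ('m, 'e \<times> real) vfield \<Rightarrow> bool" where
  "oriented_unit_normal \<A> \<F> g N \<longleftrightarrow> vector_field \<A> N \<and>
     (\<forall>c\<in>\<A>. \<forall>p\<in>cdom c. g c p (N c p) (N c p) = 1 \<and>
        (\<forall>v\<in>tangent_leaf \<F> c p. g c p (N c p) v = 0)) \<and>
     (\<forall>e\<in>\<F>. \<forall>p\<in>cdom e. snd (N e p) > 0)"

definition leaf_part ::
  "('m, 'b::euclidean_space) metric_field \<Rightarrow> ('m, 'b) vfield \<Rightarrow>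
     ('m, 'b) chart \<Rightarrow> 'm \<Rightarrow> 'b \<Rightarrow> 'b" where
  "leaf_part g N c p v = v - g c p v (N c p) *\<^sub>R N c p"

definition g_hat ::
  "('m, 'b::euclidean_space) metric_field \<Rightarrow> ('m, 'b) vfield \<Rightarrow> ('m, 'b) metric_field" where
  "g_hat g N c p u v = g c p (leaf_part g N c p u) (leaf_part g N c p v)"

definition weingarten ::
  "('m, 'b::euclidean_space) metric_field \<Rightarrow> ('m, 'b) conn \<Rightarrow> ('m, 'b) vfield \<Rightarrow>
     ('m, 'b) chart \<Rightarrow> 'm \<Rightarrow> 'b \<Rightarrow> 'b" where
  "weingarten g \<Gamma> N c p v = - cov_deriv \<Gamma> c (N c) p (leaf_part g N c p v)"

definition b_hat ::
  "('m, 'b::euclidean_space) metric_field \<Rightarrow> ('m, 'b) conn \<Rightarrow> ('m, 'b) vfield \<Rightarrow>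
     nat \<Rightarrow> ('m, 'b) metric_field" where
  "b_hat g \<Gamma> N j c p u v = g_hat g N c p ((weingarten g \<Gamma> N c p ^^ j) u) v"

text \<open>Eigenvalues of the Weingarten operator on the tangent space of the leaf. They and their
  multiplicities do not depend on the chart around \<open>p\<close> used to express the operator.\<close>

definition curvature_eigenspace ::
  "('m, 'e::euclidean_space \<times> real) chart set \<Rightarrow> ('m, 'e \<times> real) metric_field \<Rightarrow>
     ('m, 'e \<times> real) conn \<Rightarrow> ('m, 'e \<times> real) vfield \<Rightarrow>
     ('m, 'e \<times> real) chart \<Rightarrow> 'm \<Rightarrow> real \<Rightarrow> ('e \<times> real) set" where
  "curvature_eigenspace \<F> g \<Gamma> N c p k =
     {v \<in> tangent_leaf \<F> c p. weingarten g \<Gamma> N c p v = k *\<^sub>R v}"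

definition principal_curvatures ::
  "('m, 'e::euclidean_space \<times> real) chart set \<Rightarrow> ('m, 'e \<times> real) metric_field \<Rightarrow>
     ('m, 'e \<times> real) conn \<Rightarrow> ('m, 'e \<times> real) vfield \<Rightarrow>
     ('m, 'e \<times> real) chart \<Rightarrow> 'm \<Rightarrow> real set" where
  "principal_curvatures \<F> g \<Gamma> N c p = {k. \<exists>v\<in>curvature_eigenspace \<F> g \<Gamma> N c p k. v \<noteq> 0}"

definition chart_around :: "('m, 'b) chart set \<Rightarrow> 'm \<Rightarrow> ('m, 'b) chart" where
  "chart_around \<A> p = (SOME c. c \<in> \<A> \<and> p \<in> cdom c)"

text \<open>Power sums of the principal curvatures, counted with multiplicity. The operator is self-adjoint
  on the tangent space of the leaf, so the multiplicity of an eigenvalue is the dimension of its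
  eigenspace.\<close>

definition power_sum ::
  "('m, 'e::euclidean_space \<times> real) chart set \<Rightarrow> ('m, 'e \<times> real) chart set \<Rightarrow>
     ('m, 'e \<times> real) metric_field \<Rightarrow> ('m, 'e \<times> real) conn \<Rightarrow> ('m, 'e \<times> real) vfield \<Rightarrow>
     nat \<Rightarrow> 'm \<Rightarrow> real" where
  "power_sum \<A> \<F> g \<Gamma> N i p =
     (let c = chart_around \<A> p in
        \<Sum>k\<in>principal_curvatures \<F> g \<Gamma> N c p. real (dim (curvature_eigenspace \<F> g \<Gamma> N c p k)) * k ^ i)"

definition smooth_metric_family ::
  "('m, 'b::euclidean_space) chart set \<Rightarrow> real set \<Rightarrow> (real \<Rightarrow> ('m, 'b) metric_field) \<Rightarrow> bool" where
  "smooth_metric_family \<A> T g \<longleftrightarrow> (\<forall>t\<in>T. riemannian_metric \<A> (g t)) \<and>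
     (\<forall>c\<in>\<A>. \<forall>u v. smooth_on (T \<times> coord c ` cdom c) (\<lambda>(t, x). g t c (chart_inv c x) u v))"

text \<open>Here \<open>T\<close> is the time interval, \<open>\<Gamma> t\<close> the Levi-Civita connection of \<open>g t\<close>, and the leaves have
  dimension \<open>DIM('e)\<close>. The normal field \<open>N\<close> does not depend on time.\<close>

definition extrinsic_geometric_flow ::
  "('m, 'e::euclidean_space \<times> real) chart set \<Rightarrow> ('m, 'e \<times> real) chart set \<Rightarrow>
     ('m, 'e \<times> real) vfield \<Rightarrow> real set \<Rightarrow> (nat \<Rightarrow> real \<Rightarrow> 'm \<Rightarrow> real) \<Rightarrow>
     (real \<Rightarrow> ('m, 'e \<times> real) metric_field) \<Rightarrow> (real \<Rightarrow> ('m, 'e \<times> real) conn) \<Rightarrow> bool" where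
  "extrinsic_geometric_flow \<A> \<F> N T f g \<Gamma> \<longleftrightarrow>
     is_interval T \<and> 0 \<in> T \<and> smooth_metric_family \<A> T g \<and>
     (\<forall>t\<in>T. levi_civita \<A> (g t) (\<Gamma> t) \<and> oriented_unit_normal \<A> \<F> (g t) N) \<and>
     (\<forall>t\<in>T. \<forall>c\<in>\<A>. \<forall>p\<in>cdom c. \<forall>u v.
        ((\<lambda>s. g s c p u v) has_real_derivative
           (\<Sum>j<DIM('e). f j t p * b_hat (g t) (\<Gamma> t) N j c p u v)) (at t within T))"

definition integral_curve ::
  "('m::topological_space, 'b::euclidean_space) chart set \<Rightarrow> ('m, 'b) vfield \<Rightarrow>
     real set \<Rightarrow> (real \<Rightarrow> 'm) \<Rightarrow> bool" where
  "integral_curve \<A> X I \<gamma> \<longleftrightarrow> open I \<and> is_interval I \<and> continuous_on I \<gamma> \<and>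
     (\<forall>r\<in>I. \<forall>c\<in>\<A>. \<gamma> r \<in> cdom c \<longrightarrow>
        ((\<lambda>s. coord c (\<gamma> s)) has_vector_derivative X c (\<gamma> r)) (at r))"

definition flow_domain ::
  "('m::topological_space, 'b::euclidean_space) chart set \<Rightarrow> ('m, 'b) vfield \<Rightarrow> (real \<times> 'm) set" where
  "flow_domain \<A> X =
     {(r, p). \<exists>I \<gamma>. integral_curve \<A> X I \<gamma> \<and> 0 \<in> I \<and> r \<in> I \<and> \<gamma> 0 = p}"

text \<open>The values of \<open>\<psi>\<close> outside the flow domain (the domain of the maximal local flow) are
  irrelevant.\<close>

definition is_flow ::
  "('m::topological_space, 'b::euclidean_space) chart set \<Rightarrow> ('m, 'b) vfield \<Rightarrow>
     (real \<Rightarrow> 'm \<Rightarrow> 'm) \<Rightarrow> bool" where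
  "is_flow \<A> X \<psi> \<longleftrightarrow>
     (\<forall>I \<gamma>. integral_curve \<A> X I \<gamma> \<and> 0 \<in> I \<longrightarrow> (\<forall>r\<in>I. \<psi> r (\<gamma> 0) = \<gamma> r))"

definition scale_field :: "real \<Rightarrow> ('m, 'b::real_vector) vfield \<Rightarrow> ('m, 'b) vfield" where
  "scale_field a X c p = a *\<^sub>R X c p"

definition time_chart :: "('m, 'b) chart \<Rightarrow> ('m \<times> real, 'b \<times> real) chart" where
  "time_chart c = (cdom c \<times> UNIV, \<lambda>(p, s). (coord c p, s))"

definition time_atlas :: "('m, 'b) chart set \<Rightarrow> ('m \<times> real, 'b \<times> real) chart set" where
  "time_atlas \<A> = time_chart ` \<A>"

definition base_chart :: "('m \<times> real, 'b \<times> real) chart \<Rightarrow> ('m, 'b) chart" where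
  "base_chart k = (fst ` cdom k, \<lambda>p. fst (coord k (p, 0)))"

lemma base_chart_time_chart [simp]: "base_chart (time_chart c) = c"
  by (cases c) (simp add: base_chart_def time_chart_def)

text \<open>The field \<open>\<partial>\<^sub>t + X\<close>: its components in \<open>time_chart c\<close> are those of \<open>X\<close> in \<open>c\<close>, followed by 1.\<close>

definition time_plus_field :: "('m, 'b) vfield \<Rightarrow> ('m \<times> real, 'b \<times> real) vfield" where
  "time_plus_field X k z = (X (base_chart k) (fst z), 1)"

end

theory Submission
  imports Defs
begin

text \<open>Write \<open>q = g_hat\<close> and \<open>b = b_hat 1\<close>. Since \<open>b\<close> annihilates \<open>N\<close>, the covector \<open>g(_, N)\<close> does not
  depend on time, so \<open>q\<close> satisfies \<open>\<partial>\<^sub>t q = C b\<close>. As \<open>C b\<close> is the time derivative of \<open>g\<close>, it is symmetric,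
  and a computation with the Levi-Civita connection gives \<open>b = - L\<^sub>N q / 2\<close> on all vectors.
  Hence \<open>\<partial>\<^sub>t q = - (C/2) L\<^sub>N q\<close>, and, as the partial derivatives in time and space commute,
  \<open>\<partial>\<^sub>t b = - (C/2) L\<^sub>N b\<close>: both forms are carried along by the flow of \<open>\<partial>\<^sub>t + (C/2) N\<close>.
  The principal curvatures are the eigenvalues of \<open>b\<close> relative to \<open>q\<close> modulo the common null
  direction \<open>N\<close>, so they are invariant too. The differential of the flow is replaced by the solution
  of the linearized equation along a single integral curve, so that no smooth dependence of the flow
  on its initial point is needed. If \<open>C = 0\<close>, the metric is constant.\<close>

section \<open>Calculus\<close>

lemma Ck_on_subset: "Ck_on k S f \<Longrightarrow> S' \<subseteq> S \<Longrightarrow> Ck_on k S' f"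
proof (induction k arbitrary: f)
  case 0 then show ?case by (auto intro: continuous_on_subset)
next
  case (Suc k)
  then obtain f' where f': "\<forall>x\<in>S. (f has_derivative f' x) (at x within S)" "\<forall>v. Ck_on k S (\<lambda>x. f' x v)"
    by auto
  then have "\<forall>x\<in>S'. (f has_derivative f' x) (at x within S')" "\<forall>v. Ck_on k S' (\<lambda>x. f' x v)"
    using Suc by (blast intro: has_derivative_subset)+
  then show ?case by auto
qed

lemma smooth_on_subset: "smooth_on S f \<Longrightarrow> S' \<subseteq> S \<Longrightarrow> smooth_on S' f"
  by (auto simp: smooth_on_def intro: Ck_on_subset)

lemma Ck_on_const: "Ck_on k S (\<lambda>_. a)"
proof (induction k arbitrary: a)
  case (Suc k)
  show ?case unfolding Ck_on.simps
    by (rule exI[of _ "\<lambda>_ _. 0"]) (use Suc in auto)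
qed auto

lemma smooth_on_const: "smooth_on S (\<lambda>_. a)"
  by (auto simp: smooth_on_def Ck_on_const)

lemma Ck_on_1D:
  assumes "Ck_on (Suc 0) S f"
  obtains f' where "\<And>x. x \<in> S \<Longrightarrow> (f has_derivative f' x) (at x within S)"
    "\<And>v. continuous_on S (\<lambda>x. f' x v)"
  using assms by auto

lemma smooth_on_open_has_derivative:
  assumes "smooth_on S f" "open S" "x \<in> S"
  shows "(f has_derivative frechet_derivative f (at x)) (at x)"
proof -
  from assms(1) have "Ck_on (Suc 0) S f" by (simp only: smooth_on_def)
  then obtain f' where "(f has_derivative f' x) (at x within S)"
    using assms(3) by (elim Ck_on_1D) auto
  then have *: "(f has_derivative f' x) (at x)" by (simp only: at_within_open[OF assms(3,2)])
  show ?thesis using * unfolding frechet_derivative_at[OF *, symmetric] .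
qed

lemma smooth_on_open_continuous_derivative:
  assumes "smooth_on S f" "open S"
  shows "continuous_on S (\<lambda>x. frechet_derivative f (at x) v)"
proof -
  from assms(1) have "Ck_on (Suc 0) S f" by (simp only: smooth_on_def)
  then obtain f' where f': "\<And>x. x \<in> S \<Longrightarrow> (f has_derivative f' x) (at x within S)"
    "\<And>v. continuous_on S (\<lambda>x. f' x v)" by (elim Ck_on_1D) auto
  have "f' x = frechet_derivative f (at x)" if "x \<in> S" for x
    using f'(1)[OF that] assms(2) that frechet_derivative_at by (metis at_within_open)
  then show ?thesis using f'(2)[of v] by (metis (mono_tags, lifting) continuous_on_cong)
qed

lemma has_real_derivative_transform:
  fixes f g :: "real \<Rightarrow> real"
  assumes "x \<in> S" "\<And>y. y \<in> S \<Longrightarrow> g y = f y" "(f has_real_derivative D) (at x within S)"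
  shows "(g has_real_derivative D) (at x within S)"
  using assms unfolding has_field_derivative_def by (rule has_derivative_transform)

text \<open>The interval is nondegenerate, so even the one-sided derivative at an endpoint is
  unique. Identities between derivatives at the ends of the time interval rest on this.\<close>

lemma has_real_derivative_unique_interval:
  assumes "a < b" "x \<in> {a..b}" "(f has_real_derivative D) (at x within {a..b})"
    "(f has_real_derivative D') (at x within {a..b})"
  shows "D = D'"
  using vector_derivative_unique_within_closed_interval[of a b x f D D'] assms
  by (simp add: has_real_derivative_iff_has_vector_derivative)

text \<open>A version of Schwarz's theorem that includes the endpoints of the time interval. The
  function is its initial value plus the time integral of its time derivative; differentiating under
  the integral in direction \<open>w\<close>, and then with respect to the upper limit, gives the
  mixed derivative in the other order.\<close>

lemma mixed_partials_commute:
  fixes F :: "real \<times> 'a::real_normed_vector \<Rightarrow> real"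
  assumes ab: "a < b" and s: "s \<in> {a..b}" and U: "open U" "x \<in> U"
    and F': "\<And>z. z \<in> {a..b} \<times> U \<Longrightarrow> (F has_derivative F' z) (at z within {a..b} \<times> U)"
    and F'': "Ck_on (Suc 0) ({a..b} \<times> U) (\<lambda>z. F' z (1, 0))"
      "Ck_on (Suc 0) ({a..b} \<times> U) (\<lambda>z. F' z (0, w))"
    and P': "((\<lambda>z. F' z (1, 0)) has_derivative P') (at (s, x) within {a..b} \<times> U)"
  shows "((\<lambda>\<sigma>. F' (\<sigma>, x) (0, w)) has_real_derivative P' (0, w)) (at s within {a..b})"
proof -
  let ?S = "{a..b} \<times> U"
  obtain P1 where P1: "\<And>z. z \<in> ?S \<Longrightarrow> ((\<lambda>z. F' z (1, 0)) has_derivative P1 z) (at z within ?S)"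
    "\<And>v. continuous_on ?S (\<lambda>z. P1 z v)" using F''(1) by (elim Ck_on_1D) auto
  have cP: "continuous_on ?S (\<lambda>z. F' z (1, 0))"
    by (rule has_derivative_continuous_on[OF P1(1)])
  obtain e where e: "e > 0" "ball x e \<subseteq> U" using U by (meson open_contains_ball)
  \<comment> \<open>The segment of all \<open>x + r w\<close> with \<open>r\<close> in
    \<open>{-d..d}\<close> stays in the ball of radius \<open>e\<close>; the summand 1 covers the
    case \<open>w = 0\<close>.\<close>
  define d where "d = e / (norm w + 1) / 2"
  have d: "d > 0" using e by (simp add: d_def add_nonneg_pos)
  have xr: "x + r *\<^sub>R w \<in> U" if "r \<in> {-d..d}" for r
  proof -
    have "norm (r *\<^sub>R w) \<le> d * norm w" using that by (auto intro!: mult_right_mono)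
    also have "\<dots> < e"
    proof -
      have "norm w < 2 * (norm w + 1)" by (rule order.strict_trans2[of _ "norm w + 1"]) auto
      then have "e * norm w < e * (2 * (norm w + 1))" using e(1) by (rule mult_strict_left_mono)
      moreover have "norm w + 1 > 0" by (simp add: add_nonneg_pos)
      ultimately show ?thesis unfolding d_def by (simp add: field_simps)
    qed
    finally show ?thesis using e(2) by (auto simp: dist_norm)
  qed
  have hd: "((\<lambda>r. h (\<sigma>, x + r *\<^sub>R w)) has_real_derivative h' (0, w)) (at r within {-d..d})"
    if "(h has_derivative h') (at (\<sigma>, x + r *\<^sub>R w) within ?S)" "\<sigma> \<in> {a..b}" "r \<in> {-d..d}" for h h' \<sigma> r
  proof -
    have "((\<lambda>r. (\<sigma>, x + r *\<^sub>R w)) has_derivative (\<lambda>y. (0, y *\<^sub>R w))) (at r within {-d..d})"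
      by (auto intro!: derivative_eq_intros)
    then have "((\<lambda>r. h (\<sigma>, x + r *\<^sub>R w)) has_derivative (\<lambda>y. h' (0, y *\<^sub>R w))) (at r within {-d..d})"
      by (rule has_derivative_in_compose)
         (rule has_derivative_subset[OF that(1)], use that xr in auto)
    moreover have "h' (0, y *\<^sub>R w) = h' (0, w) * y" for y
      using linear_scale[OF has_derivative_linear[OF that(1)], of y "(0, w)"] by simp
    ultimately show ?thesis
      unfolding has_field_derivative_def by (elim has_derivative_eq_rhs) auto
  qed
  have F1: "F (\<sigma>, y) = F (a, y) + integral {a..\<sigma>} (\<lambda>\<tau>. F' (\<tau>, y) (1, 0))"
    if \<sigma>y: "\<sigma> \<in> {a..b}" "y \<in> U" for \<sigma> y
  proof -
    have "((\<lambda>\<tau>. F (\<tau>, y)) has_vector_derivative F' (\<tau>, y) (1, 0)) (at \<tau> within {a..\<sigma>})"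
      if \<tau>: "\<tau> \<in> {a..\<sigma>}" for \<tau>
    proof -
      have z: "(\<tau>, y) \<in> ?S" using \<tau> \<sigma>y by auto
      have "((\<lambda>\<tau>. (\<tau>, y)) has_derivative (\<lambda>h. (h, 0))) (at \<tau> within {a..\<sigma>})"
        by (auto intro!: derivative_eq_intros)
      then have *: "((\<lambda>\<tau>. F (\<tau>, y)) has_derivative (\<lambda>h. F' (\<tau>, y) (h, 0))) (at \<tau> within {a..\<sigma>})"
        by (rule has_derivative_in_compose)
           (rule has_derivative_subset[OF F'[OF z]], use \<sigma>y in auto)
      have "F' (\<tau>, y) (h, 0) = h *\<^sub>R F' (\<tau>, y) (1, 0)" for h
        using linear_scale[OF has_derivative_linear[OF F'[OF z]], of h "(1, 0)"] by simp
      then have "(\<lambda>h. F' (\<tau>, y) (h, 0)) = (\<lambda>h. h *\<^sub>R F' (\<tau>, y) (1, 0))"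
        by (rule ext)
      with * show ?thesis by (simp only: has_vector_derivative_def)
    qed
    then have "((\<lambda>\<tau>. F' (\<tau>, y) (1, 0)) has_integral F (\<sigma>, y) - F (a, y)) {a..\<sigma>}"
      using \<sigma>y(1) by (intro fundamental_theorem_of_calculus) auto
    then show ?thesis by (simp add: integral_unique)
  qed
  have cP1: "continuous_on ?S (\<lambda>z. P1 z (0, w))" by (rule P1(2))
  \<comment> \<open>Both sides of \<open>F1\<close> are differentiated along this segment at
    \<open>r = 0\<close>. The right side uses the Leibniz rule, and uniqueness of the derivative
    equates the results.\<close>
  have Q: "F' (\<sigma>, x) (0, w) = F' (a, x) (0, w) + integral {a..\<sigma>} (\<lambda>\<tau>. P1 (\<tau>, x) (0, w))"
    if \<sigma>: "\<sigma> \<in> {a..b}" for \<sigma>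
  proof -
    have "((\<lambda>r. integral (cbox a \<sigma>) (\<lambda>\<tau>. F' (\<tau>, x + r *\<^sub>R w) (1, 0))) has_field_derivative
        integral (cbox a \<sigma>) (\<lambda>\<tau>. P1 (\<tau>, x + 0 *\<^sub>R w) (0, w))) (at 0 within {-d..d})"
    proof (rule leibniz_rule_field_derivative[where f = "\<lambda>r \<tau>. F' (\<tau>, x + r *\<^sub>R w) (1, 0)"
          and fx = "\<lambda>r \<tau>. P1 (\<tau>, x + r *\<^sub>R w) (0, w)"])
      fix r \<tau> assume "r \<in> {-d..d}" "\<tau> \<in> cbox a \<sigma>"
      then show "((\<lambda>r. F' (\<tau>, x + r *\<^sub>R w) (1, 0)) has_real_derivative P1 (\<tau>, x + r *\<^sub>R w) (0, w)) (at r within {-d..d})"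
        using hd[of "\<lambda>z. F' z (1, 0)" "P1 (\<tau>, x + r *\<^sub>R w)" \<tau> r] P1(1)[of "(\<tau>, x + r *\<^sub>R w)"] xr \<sigma> by simp
    next
      fix r assume "r \<in> {-d..d}"
      then show "(\<lambda>\<tau>. F' (\<tau>, x + r *\<^sub>R w) (1, 0)) integrable_on cbox a \<sigma>"
        using xr \<sigma>
        by (intro integrable_continuous continuous_on_compose2[OF cP, where f = "\<lambda>\<tau>. (\<tau>, x + r *\<^sub>R w)"])
           (auto intro!: continuous_intros)
    next
      show "continuous_on ({-d..d} \<times> cbox a \<sigma>) (\<lambda>(r, \<tau>). P1 (\<tau>, x + r *\<^sub>R w) (0, w))"
        unfolding split_beta
        by (rule continuous_on_compose2[OF cP1, where f = "\<lambda>p. (snd p, x + fst p *\<^sub>R w)"])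
           (use xr \<sigma> in \<open>auto intro!: continuous_intros\<close>)
    qed (use d in auto)
    then have 1: "((\<lambda>r. F (a, x + r *\<^sub>R w) + integral (cbox a \<sigma>) (\<lambda>\<tau>. F' (\<tau>, x + r *\<^sub>R w) (1, 0))) has_field_derivative
        F' (a, x) (0, w) + integral (cbox a \<sigma>) (\<lambda>\<tau>. P1 (\<tau>, x) (0, w))) (at 0 within {-d..d})"
      using hd[of F "F' (a, x)" a 0] F'[of "(a, x)"] d ab U by (intro DERIV_add) auto
    have 2: "((\<lambda>r. F (\<sigma>, x + r *\<^sub>R w)) has_real_derivative F' (\<sigma>, x) (0, w)) (at 0 within {-d..d})"
      using hd[of F "F' (\<sigma>, x)" \<sigma> 0] F'[of "(\<sigma>, x)"] d \<sigma> U by simp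
    have "((\<lambda>r. F (\<sigma>, x + r *\<^sub>R w)) has_real_derivative F' (a, x) (0, w) + integral (cbox a \<sigma>) (\<lambda>\<tau>. P1 (\<tau>, x) (0, w))) (at 0 within {-d..d})"
      by (rule has_real_derivative_transform[OF _ _ 1]) (use d F1[OF \<sigma> xr] in auto)
    from has_real_derivative_unique_interval[OF _ _ 2 this] show ?thesis using d by simp
  qed
  have "((\<lambda>\<sigma>. F' (a, x) (0, w) + integral {a..\<sigma>} (\<lambda>\<tau>. P1 (\<tau>, x) (0, w))) has_real_derivative P1 (s, x) (0, w)) (at s within {a..b})"
  proof -
    have "continuous_on {a..b} (\<lambda>\<tau>. P1 (\<tau>, x) (0, w))"
      by (rule continuous_on_compose2[OF cP1, where f = "\<lambda>\<tau>. (\<tau>, x)"])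
         (use U in \<open>auto intro!: continuous_intros\<close>)
    from DERIV_add[OF DERIV_const integral_has_real_derivative[OF this s]] show ?thesis by simp
  qed
  then have R: "((\<lambda>\<sigma>. F' (\<sigma>, x) (0, w)) has_real_derivative P1 (s, x) (0, w)) (at s within {a..b})"
    by (rule has_real_derivative_transform[rotated 2]) (rule s, erule Q)
  \<comment> \<open>\<open>P1 (s, x)\<close> and \<open>P'\<close> are derivatives of the same
    function at the same point. Along the segment in direction \<open>w\<close> this becomes
    uniqueness of a derivative in one real variable.\<close>
  have PP: "P1 (s, x) (0, w) = P' (0, w)"
  proof -
    have sx: "(s, x) \<in> ?S" using s U by auto
    have "((\<lambda>r. F' (s, x + r *\<^sub>R w) (1, 0)) has_real_derivative P1 (s, x) (0, w)) (at 0 within {-d..d})"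
      using hd[of "\<lambda>z. F' z (1, 0)" "P1 (s, x)" s 0] P1(1)[OF sx] s d by simp
    moreover have "((\<lambda>r. F' (s, x + r *\<^sub>R w) (1, 0)) has_real_derivative P' (0, w)) (at 0 within {-d..d})"
      using hd[of "\<lambda>z. F' z (1, 0)" P' s 0] P' s d by simp
    ultimately show ?thesis
      by (rule has_real_derivative_unique_interval[of "-d" d 0, rotated 2]) (use d in auto)
  qed
  from R show ?thesis unfolding PP .
qed

text \<open>Picard's operator is a contraction with constant 1/4 because the interval is short
  compared with \<open>B\<close>. The same bound keeps the solution starting at the identity within
  distance 1/3 of the identity, hence injective.\<close>

lemma linear_ode_exists:
  fixes L :: "real \<Rightarrow> 'a::euclidean_space \<Rightarrow>\<^sub>L 'a"
  assumes ab: "a \<le> b" and L: "continuous_on {a..b} L" and B: "\<And>s. s \<in> {a..b} \<Longrightarrow> norm (L s) \<le> B"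
    and small: "B * (b - a) \<le> 1/4"
  shows "\<exists>\<Phi> :: real \<Rightarrow> 'a \<Rightarrow>\<^sub>L 'a. \<forall>s\<in>{a..b}.
    (\<Phi> has_vector_derivative L s o\<^sub>L \<Phi> s) (at s within {a..b}) \<and> inj (blinfun_apply (\<Phi> s))"
proof -
  define I where "I \<Phi> s = integral {a..s} (\<lambda>r. L r o\<^sub>L apply_bcontfun \<Phi> r)"
    for \<Phi> :: "real \<Rightarrow>\<^sub>C ('a \<Rightarrow>\<^sub>L 'a)" and s
  \<comment> \<open>Clamping the argument to \<open>{a..b}\<close> extends the integral to a bounded
    continuous function on the whole line, so that Banach's theorem applies in the complete space of
    such functions.\<close>
  define K where "K \<Phi> = Bcontfun (\<lambda>s. id_blinfun + I \<Phi> (max a (min b s)))" for \<Phi>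
  have B0: "0 \<le> B" using order_trans[OF norm_ge_zero B[of a]] ab by simp
  have cont: "continuous_on {a..b} (\<lambda>r. L r o\<^sub>L apply_bcontfun \<Phi> r)" for \<Phi>
    by (intro continuous_intros L continuous_on_apply_bcontfun)
  have int: "(\<lambda>r. L r o\<^sub>L apply_bcontfun \<Phi> r) integrable_on {a..s}" if "s \<in> {a..b}" for \<Phi> s
    using that by (intro integrable_continuous_real continuous_on_subset[OF cont]) auto
  have cmp: "norm (L r o\<^sub>L X) \<le> B * norm X" if "r \<in> {a..b}" for r and X :: "'a \<Rightarrow>\<^sub>L 'a"
    by (rule order_trans[OF norm_blinfun_compose]) (use B[OF that] in \<open>auto intro: mult_right_mono\<close>)
  have bnd: "norm (integral {a..s} (\<lambda>r. L r o\<^sub>L X r)) \<le> M / 4"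
    if "s \<in> {a..b}" "continuous_on {a..b} X" "\<And>r. norm (X r) \<le> M" for s M and X :: "real \<Rightarrow> 'a \<Rightarrow>\<^sub>L 'a"
  proof -
    have M: "M \<ge> 0" by (rule order_trans[OF norm_ge_zero that(3)])
    have "norm (integral {a..s} (\<lambda>r. L r o\<^sub>L X r)) \<le> (B * M) * (s - a)"
    proof (rule integral_bound)
      show "continuous_on {a..s} (\<lambda>r. L r o\<^sub>L X r)"
        by (rule continuous_on_subset[of "{a..b}"]) (use that L in \<open>auto intro!: continuous_intros\<close>)
      show "\<And>t. t \<in> {a..s} \<Longrightarrow> norm (L t o\<^sub>L X t) \<le> B * M"
        using that B0 by (intro order_trans[OF cmp]) (auto intro!: mult_left_mono)
    qed (use that in auto)
    also have "\<dots> \<le> (B * (b - a)) * M" using that M B0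
      by (auto simp: mult_ac intro!: mult_left_mono)
    also have "\<dots> \<le> 1/4 * M" using small M by (intro mult_right_mono) auto
    finally show ?thesis by simp
  qed
  have clamp: "max a (min b s) \<in> {a..b}" for s using ab by auto
  have Kapp: "apply_bcontfun (K \<Phi>) = (\<lambda>s. id_blinfun + I \<Phi> (max a (min b s)))" for \<Phi>
  proof -
    have c: "continuous_on {a..b} (I \<Phi>)"
      unfolding I_def by (rule indefinite_integral_continuous_1[OF integrable_continuous_real[OF cont]])
    have "(\<lambda>s. id_blinfun + I \<Phi> (max a (min b s))) \<in> bcontfun"
    proof (rule bcontfun_normI)
      show "continuous_on UNIV (\<lambda>s. id_blinfun + I \<Phi> (max a (min b s)))"
        using clamp by (intro continuous_intros continuous_on_compose2[OF c]) auto
      fix s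
      have "norm (I \<Phi> (max a (min b s))) \<le> norm \<Phi> / 4"
        unfolding I_def by (rule bnd[OF clamp]) (auto simp: norm_bounded)
      then show "norm (id_blinfun + I \<Phi> (max a (min b s))) \<le> norm (id_blinfun :: 'a \<Rightarrow>\<^sub>L 'a) + norm \<Phi> / 4"
        by (rule order_trans[OF norm_triangle_mono[OF order_refl]]) simp
    qed
    then show ?thesis by (simp add: K_def Bcontfun_inverse)
  qed
  have contr: "dist (K \<Phi>) (K \<Psi>) \<le> 1/4 * dist \<Phi> \<Psi>" for \<Phi> \<Psi>
  proof (rule dist_bound)
    fix s
    let ?s = "max a (min b s)"
    have "I \<Phi> ?s - I \<Psi> ?s = integral {a..?s} (\<lambda>r. L r o\<^sub>L (apply_bcontfun \<Phi> r - apply_bcontfun \<Psi> r))"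
      unfolding I_def by (subst integral_diff[symmetric, OF int int, OF clamp clamp])
        (simp add: bounded_bilinear.diff_right[OF bounded_bilinear_blinfun_compose])
    also have "norm \<dots> \<le> dist \<Phi> \<Psi> / 4"
      by (rule bnd[OF clamp]) (use dist_bounded in \<open>auto simp: dist_norm[symmetric] intro!: continuous_intros\<close>)
    finally show "dist (apply_bcontfun (K \<Phi>) s) (apply_bcontfun (K \<Psi>) s) \<le> 1/4 * dist \<Phi> \<Psi>"
      by (simp add: Kapp dist_norm)
  qed
  have "\<exists>!\<Phi>\<in>UNIV. K \<Phi> = \<Phi>"
    by (rule Banach_fix[where c="1/4"]) (use contr in \<open>auto simp: complete_UNIV\<close>)
  then obtain \<Phi> where fixp: "K \<Phi> = \<Phi>" by auto
  have \<Phi>: "apply_bcontfun \<Phi> s = id_blinfun + I \<Phi> s" if "s \<in> {a..b}" for s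
  proof -
    have "max a (min b s) = s" using that by auto
    then show ?thesis using fun_cong[OF Kapp[of \<Phi>], of s] by (simp add: fixp)
  qed
  have nI: "norm (I \<Phi> (max a (min b s))) \<le> norm \<Phi> / 4" for s
    unfolding I_def by (rule bnd[OF clamp]) (auto simp: norm_bounded)
  have "norm \<Phi> \<le> 1 + norm \<Phi> / 4"
  proof (rule norm_bound)
    fix s
    have "apply_bcontfun \<Phi> s = id_blinfun + I \<Phi> (max a (min b s))"
      using fun_cong[OF Kapp[of \<Phi>], of s] by (simp add: fixp)
    then show "norm (apply_bcontfun \<Phi> s) \<le> 1 + norm \<Phi> / 4"
      using norm_triangle_mono[OF norm_blinfun_id_le nI[of s]] by simp
  qed
  \<comment> \<open>The fixed point occurs on both sides of its own estimate; solving for its norm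
    gives 4/3, so the integral term has norm at most 1/3.\<close>
  then have n\<Phi>: "norm \<Phi> \<le> 4/3" by simp
  show ?thesis
  proof (intro exI[of _ "apply_bcontfun \<Phi>"] ballI conjI)
    fix s assume s: "s \<in> {a..b}"
    have "((\<lambda>s. id_blinfun + I \<Phi> s) has_vector_derivative L s o\<^sub>L apply_bcontfun \<Phi> s) (at s within {a..b})"
      using integral_has_vector_derivative[OF cont s] unfolding I_def by (auto intro!: derivative_eq_intros)
    then show "(apply_bcontfun \<Phi> has_vector_derivative L s o\<^sub>L apply_bcontfun \<Phi> s) (at s within {a..b})"
      by (rule has_vector_derivative_transform[rotated 2]) (use s \<Phi> in auto)
    have mm: "max a (min b s) = s" using s by auto
    have nn: "norm (I \<Phi> s) \<le> 1/3" using nI[of s] n\<Phi> unfolding mm by simp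
    \<comment> \<open>A kernel vector satisfies \<open>v = - I \<Phi> s v\<close>, which is
      impossible for \<open>v\<close> nonzero because the operator \<open>I \<Phi> s\<close> has
      norm below 1.\<close>
    have "v = 0" if "apply_bcontfun \<Phi> s v = 0" for v
    proof -
      have "v = - I \<Phi> s v" using that \<Phi>[OF s] by (simp add: blinfun.add_left eq_neg_iff_add_eq_0)
      then have "norm v \<le> norm (I \<Phi> s) * norm v" by (metis norm_blinfun norm_minus_cancel)
      also have "\<dots> \<le> 1/3 * norm v" using nn by (intro mult_right_mono) auto
      finally show ?thesis by simp
    qed
    then show "inj (blinfun_apply (apply_bcontfun \<Phi> s))"
      by (simp add: linear_injective_0 blinfun.bounded_linear_right bounded_linear.linear)
  qed
qed

text \<open>The product rule for a form and two vectors that all vary. The form is known to be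
  differentiable only on fixed arguments, so it is expanded in the basis into a finite sum of
  products of real functions.\<close>

lemma has_real_derivative_bilinear_family:
  fixes h :: "real \<Rightarrow> 'a::euclidean_space \<Rightarrow> 'a \<Rightarrow> real"
  assumes bil: "\<And>r. r \<in> S \<Longrightarrow> bilinear (h r)" and "s \<in> S"
    and h': "\<And>u v. ((\<lambda>r. h r u v) has_real_derivative h' u v) (at s within S)"
    and bil': "bilinear h'"
    and u: "(u has_vector_derivative u') (at s within S)"
    and v: "(v has_vector_derivative v') (at s within S)"
  shows "((\<lambda>r. h r (u r) (v r)) has_real_derivative
    (h' (u s) (v s) + h s u' (v s) + h s (u s) v')) (at s within S)"
proof -
  have exp: "k x y = (\<Sum>i\<in>Basis. \<Sum>j\<in>Basis. (x \<bullet> i) * (y \<bullet> j) * k i j)" if "bilinear k" for k :: "'a \<Rightarrow> 'a \<Rightarrow> real" and x y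
  proof -
    have "k x y = k (\<Sum>i\<in>Basis. (x \<bullet> i) *\<^sub>R i) (\<Sum>j\<in>Basis. (y \<bullet> j) *\<^sub>R j)"
      by (simp add: euclidean_representation)
    also have "\<dots> = (\<Sum>(i,j)\<in>Basis\<times>Basis. k ((x \<bullet> i) *\<^sub>R i) ((y \<bullet> j) *\<^sub>R j))"
      by (rule bilinear_sum[OF that])
    also have "\<dots> = (\<Sum>(i,j)\<in>Basis\<times>Basis. (x \<bullet> i) * (y \<bullet> j) * k i j)"
      by (intro sum.cong) (auto simp: bilinear_lmul[OF that] bilinear_rmul[OF that])
    finally show ?thesis by (simp add: sum.cartesian_product)
  qed
  have u1: "((\<lambda>r. u r \<bullet> i) has_real_derivative u' \<bullet> i) (at s within S)" for i
    using bounded_linear.has_vector_derivative[OF bounded_linear_inner_left u]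
    by (simp add: has_real_derivative_iff_has_vector_derivative)
  have v1: "((\<lambda>r. v r \<bullet> i) has_real_derivative v' \<bullet> i) (at s within S)" for i
    using bounded_linear.has_vector_derivative[OF bounded_linear_inner_left v]
    by (simp add: has_real_derivative_iff_has_vector_derivative)
  have "((\<lambda>r. \<Sum>i\<in>Basis. \<Sum>j\<in>Basis. (u r \<bullet> i) * (v r \<bullet> j) * h r i j) has_real_derivative
     (\<Sum>i\<in>Basis. \<Sum>j\<in>Basis. (u s \<bullet> i) * (v s \<bullet> j) * h' i j + (u' \<bullet> i) * (v s \<bullet> j) * h s i j
        + (u s \<bullet> i) * (v' \<bullet> j) * h s i j)) (at s within S)"
    by (intro DERIV_sum) (auto intro!: derivative_eq_intros u1 v1 h' simp: algebra_simps)
  then have "((\<lambda>r. \<Sum>i\<in>Basis. \<Sum>j\<in>Basis. (u r \<bullet> i) * (v r \<bullet> j) * h r i j) has_real_derivative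
     (h' (u s) (v s) + h s u' (v s) + h s (u s) v')) (at s within S)"
    unfolding exp[OF bil', of "u s"] exp[OF bil[OF \<open>s \<in> S\<close>], of u']
      exp[OF bil[OF \<open>s \<in> S\<close>], of "u s" v'] by (simp add: sum.distrib)
  then show ?thesis
    by (rule has_real_derivative_transform[rotated 2]) (rule \<open>s \<in> S\<close>, erule exp[OF bil])
qed

section \<open>Pencils of bilinear forms\<close>

text \<open>The left kernel of \<open>h - k q\<close>. Working with forms instead of an operator
  allows \<open>q\<close> to be degenerate, as the leaf metric is in the direction of the
  normal.\<close>

definition pencil_kernel :: "('a::euclidean_space \<Rightarrow> 'a \<Rightarrow> real) \<Rightarrow> ('a \<Rightarrow> 'a \<Rightarrow> real) \<Rightarrow> real \<Rightarrow> 'a set" where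
  "pencil_kernel h q k = {v. \<forall>w. h v w = k * q v w}"

lemma subspace_pencil_kernel:
  assumes "bilinear h" "bilinear q"
  shows "subspace (pencil_kernel h q k)"
  unfolding subspace_def pencil_kernel_def
  by (auto simp: bilinear_lzero[OF assms(1)] bilinear_lzero[OF assms(2)] bilinear_ladd[OF assms(1)]
      bilinear_ladd[OF assms(2)] bilinear_lmul[OF assms(1)] bilinear_lmul[OF assms(2)] algebra_simps)

text \<open>In finite dimension an injective endomorphism is onto, so testing against all vectors
  and testing against all images is the same, and \<open>\<Psi>\<close> maps one kernel onto the
  other.\<close>

lemma dim_pencil_kernel_congruence:
  fixes \<Psi> :: "'a::euclidean_space \<Rightarrow> 'a"
  assumes \<Psi>: "linear \<Psi>" "inj \<Psi>"
    and h: "\<And>u v. h' (\<Psi> u) (\<Psi> v) = h u v" and q: "\<And>u v. q' (\<Psi> u) (\<Psi> v) = q u v"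
  shows "dim (pencil_kernel h' q' k) = dim (pencil_kernel h q k)"
proof -
  have surj: "surj \<Psi>" by (simp add: linear_injective_imp_surjective \<Psi>)
  have "\<Psi> v \<in> pencil_kernel h' q' k \<longleftrightarrow> v \<in> pencil_kernel h q k" for v
    unfolding pencil_kernel_def mem_Collect_eq using h q by (metis surj surj_def)
  then have "pencil_kernel h' q' k = \<Psi> ` pencil_kernel h q k"
    using surj by (auto simp: image_iff) (metis surj_def)
  then show ?thesis using dim_image_eq[OF \<Psi>(1)] \<Psi>(2) by (metis inj_on_subset subset_UNIV)
qed

text \<open>The vector \<open>n\<close> lies in every kernel of the pencil, and subtracting
  \<open>\<omega> v\<close> times \<open>n\<close> projects along it to the kernel of
  \<open>\<omega>\<close>. The kernel is therefore the direct sum of its intersection with that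
  hyperplane and the line through \<open>n\<close>.\<close>

lemma dim_pencil_kernel_null_vector:
  fixes n :: "'a::euclidean_space"
  assumes bil: "bilinear h" "bilinear q" and null: "\<And>w. h n w = 0" "\<And>w. q n w = 0"
    and \<omega>: "linear \<omega>" "\<omega> n = (1::real)"
  shows "dim (pencil_kernel h q k) = dim (pencil_kernel h q k \<inter> {v. \<omega> v = 0}) + 1"
proof -
  let ?K = "pencil_kernel h q k"
  let ?S = "?K \<inter> {v. \<omega> v = 0}"
  have K: "subspace ?K" by (rule subspace_pencil_kernel[OF bil])
  have S: "subspace ?S" by (intro subspace_inter K linear_subspace_kernel[OF \<omega>(1)])
  have n: "n \<in> ?K" by (simp add: pencil_kernel_def null)
  have n0: "n \<noteq> 0" using \<omega> linear_0 by fastforce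
  have "?S \<inter> span {n} = {0}"
    using \<omega> subspace_0[OF S] by (auto simp: span_singleton linear_scale)
  moreover have "{x + y |x y. x \<in> ?S \<and> y \<in> span {n}} = ?K"
  proof (intro set_eqI iffI)
    fix v assume "v \<in> {x + y |x y. x \<in> ?S \<and> y \<in> span {n}}"
    then show "v \<in> ?K" using K n by (auto simp: span_singleton intro!: subspace_add subspace_scale)
  next
    fix v assume v: "v \<in> ?K"
    have "v - \<omega> v *\<^sub>R n \<in> ?S" using \<omega> v K n
      by (auto simp: linear_diff linear_scale intro!: subspace_diff subspace_scale)
    moreover have "\<omega> v *\<^sub>R n \<in> span {n}" by (auto simp: span_singleton)
    moreover have "v = (v - \<omega> v *\<^sub>R n) + \<omega> v *\<^sub>R n" by simp
    ultimately show "v \<in> {x + y |x y. x \<in> ?S \<and> y \<in> span {n}}" by blast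
  qed
  ultimately show ?thesis
    using dim_sums_Int[OF S subspace_span[of "{n}"]] n0 by simp
qed

text \<open>Meant for forms with one common null direction: it adds 1 to the dimension of the kernel
  for every \<open>k\<close>. Hence the strict bound in the index set and the subtraction of 1 from
  the multiplicity.\<close>

definition pencil_power_sum :: "('a::euclidean_space \<Rightarrow> 'a \<Rightarrow> real) \<Rightarrow> ('a \<Rightarrow> 'a \<Rightarrow> real) \<Rightarrow> nat \<Rightarrow> real" where
  "pencil_power_sum h q i =
    (\<Sum>k\<in>{k. dim (pencil_kernel h q k) > 1}. (real (dim (pencil_kernel h q k)) - 1) * k ^ i)"

lemma pencil_power_sum_congruence:
  fixes \<Psi> :: "'a::euclidean_space \<Rightarrow> 'a"
  assumes "linear \<Psi>" "inj \<Psi>"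
    and "\<And>u v. h' (\<Psi> u) (\<Psi> v) = h u v" and "\<And>u v. q' (\<Psi> u) (\<Psi> v) = q u v"
  shows "pencil_power_sum h' q' i = pencil_power_sum h q i"
  using dim_pencil_kernel_congruence[of \<Psi> h' h q' q, OF assms] by (simp add: pencil_power_sum_def)

section \<open>Unit fields and second fundamental forms\<close>

lemma is_chartD:
  assumes "is_chart c"
  shows "open (cdom c)" "open (coord c ` cdom c)" "continuous_on (cdom c) (coord c)"
    "continuous_on (coord c ` cdom c) (chart_inv c)"
    "\<And>p. p \<in> cdom c \<Longrightarrow> chart_inv c (coord c p) = p"
    "\<And>x. x \<in> coord c ` cdom c \<Longrightarrow> chart_inv c x \<in> cdom c \<and> coord c (chart_inv c x) = x"
  using assms unfolding is_chart_def homeomorphism_def by auto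

text \<open>The domain of a chart is open, so both functions have the same derivatives in the sense
  of \<open>has_derivative\<close>, and \<open>frechet_derivative\<close> makes the same choice for
  both, whether or not a derivative exists.\<close>

lemma chart_deriv_cong:
  assumes c: "is_chart c" and p: "p \<in> cdom c" and eq: "\<And>q. q \<in> cdom c \<Longrightarrow> h q = h' q"
  shows "chart_deriv c h p u = chart_deriv c h' p u"
proof -
  have "((\<lambda>x. h (chart_inv c x)) has_derivative D) (at (coord c p)) \<longleftrightarrow>
      ((\<lambda>x. h' (chart_inv c x)) has_derivative D) (at (coord c p))" for D
    using is_chartD[OF c] p eq
    by (intro iffI; elim has_derivative_transform_within_open[where s="coord c ` cdom c"]) auto
  then show ?thesis by (simp add: chart_deriv_def frechet_derivative_def)
qed

lemma chart_deriv_const: "chart_deriv c (\<lambda>_. a) p u = 0"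
  by (simp add: chart_deriv_def)

lemma smooth_in_chart_const: "smooth_in_chart c (\<lambda>_. a)"
  by (simp add: smooth_in_chart_def smooth_on_const)

lemma chart_deriv_eqI:
  assumes "((\<lambda>x. h (chart_inv c x)) has_derivative D) (at (coord c p))"
  shows "chart_deriv c h p = D"
  using frechet_derivative_at[OF assms] by (simp add: chart_deriv_def fun_eq_iff)

lemma smooth_in_chart_has_derivative:
  assumes "is_chart c" "p \<in> cdom c" "smooth_in_chart c h"
  shows "((\<lambda>x. h (chart_inv c x)) has_derivative chart_deriv c h p) (at (coord c p))"
  using smooth_on_open_has_derivative[of "coord c ` cdom c" "\<lambda>x. h (chart_inv c x)" "coord c p"] assms
  by (simp add: is_chartD smooth_in_chart_def chart_deriv_def[abs_def])

lemma smooth_atlas_trans_map_has_derivative: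
  assumes "smooth_atlas \<A>" "c \<in> \<A>" "d \<in> \<A>" "p \<in> cdom c \<inter> cdom d"
  shows "(trans_map c d has_derivative jac c d p) (at (coord c p))"
proof -
  have c: "is_chart c" "is_chart d" and s: "smooth_on (coord c ` (cdom c \<inter> cdom d)) (trans_map c d)"
    using assms by (auto simp: smooth_atlas_def)
  \<comment> \<open>As a preimage under the continuous inverse chart, the image of the overlap is
    open.\<close>
  have "coord c ` (cdom c \<inter> cdom d) = coord c ` cdom c \<inter> chart_inv c -` cdom d"
    using is_chartD[OF c(1)] by (auto simp: image_iff)
  then have "open (coord c ` (cdom c \<inter> cdom d))"
    using continuous_open_preimage[OF is_chartD(4,2)[OF c(1)] is_chartD(1)[OF c(2)]] by simp
  then show ?thesis
    unfolding jac_def using assms(4) by (intro smooth_on_open_has_derivative[OF s]) auto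
qed

section \<open>Geometry of a unit field at a fixed time\<close>

locale unit_field_manifold =
  fixes \<A> :: "('m::{t2_space,second_countable_topology}, 'b::euclidean_space) chart set"
    and g :: "('m, 'b) metric_field" and \<Gamma> :: "('m, 'b) conn" and N :: "('m, 'b) vfield"
  assumes atlas: "smooth_atlas \<A>"
    and metric: "riemannian_metric \<A> g"
    and connection: "levi_civita \<A> g \<Gamma>"
    and field: "vector_field \<A> N"
    and unit: "\<And>c p. c \<in> \<A> \<Longrightarrow> p \<in> cdom c \<Longrightarrow> g c p (N c p) (N c p) = 1"
begin

lemma chart: "c \<in> \<A> \<Longrightarrow> is_chart c"
  using atlas by (simp add: smooth_atlas_def)

context
  fixes c p assumes c: "c \<in> \<A>" and p: "p \<in> cdom c"
begin

lemma bil: "bilinear (g c p)" and sym: "g c p u v = g c p v u" and pos: "u \<noteq> 0 \<Longrightarrow> g c p u u > 0"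
  using metric c p unfolding riemannian_metric_def by blast+

lemmas g_simps = bilinear_ladd[OF bil] bilinear_radd[OF bil] bilinear_lmul[OF bil] bilinear_rmul[OF bil]
  bilinear_lsub[OF bil] bilinear_rsub[OF bil] bilinear_lneg[OF bil] bilinear_rneg[OF bil]
  bilinear_lzero[OF bil] bilinear_rzero[OF bil]

lemma nondegenerate: "(\<And>w. g c p u w = g c p v w) \<Longrightarrow> u = v"
  using pos[of "u - v"] by (simp add: g_simps) (metis sym less_irrefl right_minus_eq)

lemma smooth_normal: "smooth_in_chart c (N c)"
  using field c by (simp add: vector_field_def)

lemma normal_has_derivative:
  "((\<lambda>x. N c (chart_inv c x)) has_derivative chart_deriv c (N c) p) (at (coord c p))"
  by (rule smooth_in_chart_has_derivative[OF chart[OF c] p smooth_normal])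

lemma linear_chart_deriv_normal: "linear (chart_deriv c (N c) p)"
  by (rule has_derivative_linear[OF normal_has_derivative])

lemma bil_conn: "bilinear (\<Gamma> c p)"
  using connection c p by (simp add: levi_civita_def affine_connection_def)

lemma compatible:
  "smooth_in_chart c Y \<Longrightarrow> smooth_in_chart c Z \<Longrightarrow> chart_deriv c (\<lambda>q. g c q (Y q) (Z q)) p u =
     g c p (cov_deriv \<Gamma> c Y p u) (Z p) + g c p (Y p) (cov_deriv \<Gamma> c Z p u)"
  using connection c p by (simp add: levi_civita_def metric_compatible_def)

text \<open>Fields with constant components have vanishing bracket, so absence of torsion becomes
  symmetry of the Christoffel map.\<close>

lemma conn_sym: "\<Gamma> c p u v = \<Gamma> c p v u"
proof -
  have "cov_deriv \<Gamma> c (\<lambda>_. v) p u - cov_deriv \<Gamma> c (\<lambda>_. u) p v = lie_bracket c (\<lambda>_. u) (\<lambda>_. v) p"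
    using connection c p smooth_in_chart_const[of c] unfolding levi_civita_def torsion_free_def by blast
  then show ?thesis by (simp add: cov_deriv_def lie_bracket_def chart_deriv_const)
qed

lemma chart_deriv_metric:
  "chart_deriv c (\<lambda>q. g c q u v) p w = g c p (\<Gamma> c p w u) v + g c p u (\<Gamma> c p w v)"
  using compatible[OF smooth_in_chart_const smooth_in_chart_const, of u v w]
  by (simp add: cov_deriv_def chart_deriv_const)

text \<open>Koszul's formula for fields with constant components, where the bracket terms vanish. It
  shows that the metric determines the connection.\<close>

lemma koszul:
  "2 * g c p (\<Gamma> c p u v) w = chart_deriv c (\<lambda>q. g c q v w) p u + chart_deriv c (\<lambda>q. g c q u w) p v
     - chart_deriv c (\<lambda>q. g c q u v) p w"
  unfolding chart_deriv_metric
  using conn_sym[of u v] conn_sym[of u w] conn_sym[of v w] sym[of v "\<Gamma> c p u w"] sym[of u "\<Gamma> c p v w"] sym[of u "\<Gamma> c p w v"]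
  by simp

text \<open>Smoothness of the metric is given for constant arguments only; expanding the normal in
  the basis writes the function as a finite sum of products of differentiable ones.\<close>

lemma normal_covector_has_derivative:
  "((\<lambda>x. g c (chart_inv c x) w (N c (chart_inv c x))) has_derivative
     chart_deriv c (\<lambda>r. g c r w (N c r)) p) (at (coord c p))"
proof -
  let ?U = "coord c ` cdom c"
  note ch = is_chartD[OF chart[OF c]]
  have "smooth_in_chart c (\<lambda>q. g c q w i)" for i
    using metric c unfolding riemannian_metric_def by blast
  then have d: "((\<lambda>x. \<Sum>i\<in>Basis. (N c (chart_inv c x) \<bullet> i) * g c (chart_inv c x) w i) has_derivative
      (\<lambda>u. \<Sum>i\<in>Basis. (N c (chart_inv c (coord c p)) \<bullet> i) * chart_deriv c (\<lambda>q. g c q w i) p u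
         + (chart_deriv c (N c) p u \<bullet> i) * g c (chart_inv c (coord c p)) w i)) (at (coord c p))"
    by (intro has_derivative_sum has_derivative_mult has_derivative_inner_left normal_has_derivative
        smooth_in_chart_has_derivative[OF chart[OF c] p])
  have eq: "(\<Sum>i\<in>Basis. (N c (chart_inv c x) \<bullet> i) * g c (chart_inv c x) w i)
      = g c (chart_inv c x) w (N c (chart_inv c x))" if "x \<in> ?U" for x
  proof -
    have "linear (g c (chart_inv c x) w)"
      using metric c ch(6)[OF that] unfolding riemannian_metric_def bilinear_def by blast
    then have "g c (chart_inv c x) w (\<Sum>i\<in>Basis. (N c (chart_inv c x) \<bullet> i) *\<^sub>R i)
        = (\<Sum>i\<in>Basis. (N c (chart_inv c x) \<bullet> i) * g c (chart_inv c x) w i)"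
      by (simp only: linear_sum linear_scale real_scaleR_def)
    then show ?thesis by (simp add: euclidean_representation)
  qed
  obtain D' where D: "((\<lambda>x. g c (chart_inv c x) w (N c (chart_inv c x))) has_derivative D') (at (coord c p))"
    using has_derivative_transform_within_open[OF d ch(2) imageI[OF p] eq] by blast
  show ?thesis
    using D unfolding chart_deriv_eqI[of "\<lambda>r. g c r w (N c r)" c, OF D, symmetric] .
qed

abbreviation "nab \<equiv> cov_deriv \<Gamma> c (N c) p"
abbreviation "\<omega> u \<equiv> g c p u (N c p)"
abbreviation "dN \<equiv> chart_deriv c (N c) p"

lemma nabla_eq: "nab u = dN u + \<Gamma> c p u (N c p)"
  by (simp add: cov_deriv_def)

lemma linear_nabla: "linear nab"
  unfolding cov_deriv_def using linear_chart_deriv_normal bil_conn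
  by (intro linear_compose_add) (auto simp: bilinear_def)

text \<open>The derivative of the constant function \<open>g(N, N) = 1\<close> is twice this
  product.\<close>

lemma nabla_orthogonal: "g c p (nab u) (N c p) = 0"
proof -
  have "chart_deriv c (\<lambda>q. g c q (N c q) (N c q)) p u = chart_deriv c (\<lambda>_. 1) p u"
    by (rule chart_deriv_cong[OF chart[OF c] p]) (rule unit[OF c])
  then show ?thesis
    using compatible[OF smooth_normal smooth_normal, of u] sym[of "N c p" "cov_deriv \<Gamma> c (N c) p u"] by (simp add: chart_deriv_const)
qed

lemma leaf_part_eq: "leaf_part g N c p u = u - \<omega> u *\<^sub>R N c p"
  by (simp add: leaf_part_def)

lemma g_hat_eq: "g_hat g N c p u v = g c p u v - \<omega> u * \<omega> v"
  by (simp add: g_hat_def leaf_part_eq g_simps unit[OF c p] sym[of "N c p" v] algebra_simps)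

lemma weingarten_eq: "weingarten g \<Gamma> N c p u = - nab u + \<omega> u *\<^sub>R nab (N c p)"
  by (simp add: weingarten_def leaf_part_eq linear_diff[OF linear_nabla] linear_scale[OF linear_nabla])

lemma weingarten_orthogonal: "\<omega> (weingarten g \<Gamma> N c p u) = 0"
  by (simp add: weingarten_eq g_simps nabla_orthogonal)

text \<open>The image of the Weingarten operator is orthogonal to the normal, so projecting the
  arguments to the leaf changes nothing.\<close>

lemma b_hat_weingarten: "b_hat g \<Gamma> N (Suc 0) c p u v = g c p (weingarten g \<Gamma> N c p u) v"
  by (simp add: b_hat_def g_hat_eq weingarten_orthogonal)

lemma b_hat_eq: "b_hat g \<Gamma> N (Suc 0) c p u v = - g c p (nab u) v + \<omega> u * g c p (nab (N c p)) v"
  by (simp add: b_hat_weingarten weingarten_eq g_simps)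

lemma bilinear_g_hat: "bilinear (g_hat g N c p)"
  unfolding bilinear_def g_hat_eq
  by (auto intro!: linearI simp: g_simps algebra_simps)

lemma bilinear_b_hat: "bilinear (b_hat g \<Gamma> N (Suc 0) c p)"
  unfolding bilinear_def b_hat_eq
  by (auto intro!: linearI simp: g_simps algebra_simps linear_add[OF linear_nabla] linear_scale[OF linear_nabla])

text \<open>The normal is a null vector on the right because the image of the Weingarten operator is
  orthogonal to it, and on the left because the operator sends it to 0.\<close>

lemma b_hat_normal: "b_hat g \<Gamma> N (Suc 0) c p u (N c p) = 0" "b_hat g \<Gamma> N (Suc 0) c p (N c p) v = 0"
  by (simp_all add: b_hat_eq nabla_orthogonal unit[OF c p])

lemma g_hat_normal: "g_hat g N c p u (N c p) = 0" "g_hat g N c p (N c p) v = 0"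
  by (simp_all add: g_hat_eq unit[OF c p] sym[of "N c p" v])

text \<open>The arguments are not projected to the leaves: this is why the flow of \<open>N\<close> can be used, although
  it need not preserve the foliation.\<close>

lemma lie_derivative_g_hat:
  "b_hat g \<Gamma> N (Suc 0) c p u v + b_hat g \<Gamma> N (Suc 0) c p v u =
    - (chart_deriv c (\<lambda>q. g c q u v) p (N c p)
       - chart_deriv c (\<lambda>q. g c q u (N c q)) p (N c p) * \<omega> v
       - \<omega> u * chart_deriv c (\<lambda>q. g c q v (N c q)) p (N c p)
       + g_hat g N c p (dN u) v + g_hat g N c p u (dN v))"
proof -
  \<comment> \<open>Compatibility with the metric produces a Christoffel term; orthogonality of
    \<open>nab u\<close> to the normal, with symmetry of the connection, trades it for the ordinary
    derivative of the normal.\<close>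
  have d\<omega>: "chart_deriv c (\<lambda>q. g c q u (N c q)) p (N c p) = - \<omega> (dN u) + g c p u (nab (N c p))" for u
  proof -
    have "chart_deriv c (\<lambda>q. g c q u (N c q)) p (N c p) = g c p (\<Gamma> c p (N c p) u) (N c p) + g c p u (nab (N c p))"
      using compatible[OF smooth_in_chart_const smooth_normal, of u "N c p"]
      by (simp add: cov_deriv_def chart_deriv_const)
    moreover have "\<omega> (dN u) + \<omega> (\<Gamma> c p (N c p) u) = 0"
      using nabla_orthogonal[of u] conn_sym[of u "N c p"] by (simp add: nabla_eq g_simps)
    ultimately show ?thesis by simp
  qed
  show ?thesis
    unfolding d\<omega> chart_deriv_metric b_hat_eq g_hat_eq
    using conn_sym[of u "N c p"] conn_sym[of v "N c p"] sym[of u "nab v"] sym[of u "nab (N c p)"] sym[of v "nab (N c p)"]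
    by (simp add: nabla_eq g_simps algebra_simps)
qed

end

lemma chart_around: "chart_around \<A> p \<in> \<A> \<and> p \<in> cdom (chart_around \<A> p)"
proof -
  have "p \<in> (\<Union>c\<in>\<A>. cdom c)" using atlas by (simp add: smooth_atlas_def)
  then have "\<exists>c. c \<in> \<A> \<and> p \<in> cdom c" by blast
  then show ?thesis unfolding chart_around_def by (rule someI_ex)
qed

lemma metric_jac:
  assumes "c \<in> \<A>" "d \<in> \<A>" "p \<in> cdom c" "p \<in> cdom d"
  shows "g c p u v = g d p (jac c d p u) (jac c d p v)"
  using metric assms unfolding riemannian_metric_def by blast

text \<open>A change of charts preserves the metric, which is positive definite, so no nonzero
  vector is sent to 0.\<close>

lemma jac_injective:
  assumes "c \<in> \<A>" "d \<in> \<A>" "p \<in> cdom c" "p \<in> cdom d"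
  shows "linear (jac c d p)" "inj (jac c d p)"
proof -
  show lin: "linear (jac c d p)"
    using smooth_atlas_trans_map_has_derivative[OF atlas assms(1,2)] assms(3,4) has_derivative_linear by blast
  have "u = 0" if "jac c d p u = 0" for u
  proof (rule ccontr)
    assume "u \<noteq> 0"
    then have "g c p u u > 0" by (rule pos[OF assms(1,3)])
    then show False using that metric_jac[OF assms, of u u] bilinear_lzero[OF bil[OF assms(2,4)]] by simp
  qed
  then show "inj (jac c d p)" using lin by (simp add: linear_injective_0)
qed

lemma g_hat_jac:
  assumes "c \<in> \<A>" "d \<in> \<A>" "p \<in> cdom c" "p \<in> cdom d"
  shows "g_hat g N d p (jac c d p u) (jac c d p v) = g_hat g N c p u v"
proof -
  have "N d p = jac c d p (N c p)"
    using field assms unfolding vector_field_def by blast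
  then show ?thesis
    by (simp only: g_hat_eq[OF assms(1,3)] g_hat_eq[OF assms(2,4)] metric_jac[OF assms, symmetric])
qed

end

section \<open>Tangent spaces of leaves and principal curvatures as data of a pencil\<close>

locale foliated_manifold = unit_field_manifold \<A> g \<Gamma> N
  for \<A> :: "('m::{t2_space,second_countable_topology}, 'e::euclidean_space \<times> real) chart set"
    and g :: "('m, 'e \<times> real) metric_field" and \<Gamma> :: "('m, 'e \<times> real) conn"
    and N :: "('m, 'e \<times> real) vfield" +
  fixes \<F> :: "('m, 'e \<times> real) chart set"
  assumes foliation: "transversely_oriented_foliation \<A> \<F>"
    and normal: "oriented_unit_normal \<A> \<F> g N"
begin

context
  fixes c p assumes c: "c \<in> \<A>" and p: "p \<in> cdom c"
begin

text \<open>Both sides are hyperplanes, the kernels of the transverse differential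
  \<open>\<alpha> e\<close> and of the normal covector. One inclusion is orthogonality of the normal
  to the leaf; the other follows because both functionals are positive on the normal.\<close>

lemma tangent_leaf_eq: "tangent_leaf \<F> c p = {v. g c p v (N c p) = 0}"
proof -
  have FA: "\<F> \<subseteq> \<A>" and "(\<Union>e\<in>\<F>. cdom e) = UNIV"
    using foliation unfolding transversely_oriented_foliation_def by blast+
  then obtain e where e: "e \<in> \<F>" "p \<in> cdom e" by blast
  define \<alpha> where "\<alpha> e v = snd (jac c e p v)" for e v
  have deriv: "(trans_map c e has_derivative jac c e p) (at (coord c p))" if "e \<in> \<F>" "p \<in> cdom e" for e
    by (rule smooth_atlas_trans_map_has_derivative[OF atlas c]) (use that FA p in blast)+
  have lin: "linear (\<alpha> e)" if "e \<in> \<F>" "p \<in> cdom e" for e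
    unfolding \<alpha>_def using has_derivative_linear[OF has_derivative_snd[OF deriv[OF that]]] .
  have \<alpha>N: "\<alpha> e (N c p) > 0" if "e \<in> \<F>" "p \<in> cdom e" for e
  proof -
    have "N e p = jac c e p (N c p)" using field c p that FA unfolding vector_field_def by blast
    moreover have "snd (N e p) > 0" using normal that unfolding oriented_unit_normal_def by blast
    ultimately show ?thesis by (simp add: \<alpha>_def)
  qed
  \<comment> \<open>The chain rule for the local relation between two transverse coordinates makes
    their differentials positive multiples of each other, so a single foliated chart decides
    tangency.\<close>
  have proportional: "\<exists>D>0. \<forall>v. \<alpha> d v = D * \<alpha> e v" if d: "d \<in> \<F>" "p \<in> cdom d" for d
  proof -
    have "\<exists>W h. open W \<and> p \<in> W \<and> W \<subseteq> cdom e \<inter> cdom d \<and>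
        (\<forall>q\<in>W. snd (coord d q) = h (snd (coord e q)) \<and>
           (\<exists>D>0. (h has_real_derivative D) (at (snd (coord e q)))))"
      using foliation d e unfolding transversely_oriented_foliation_def by blast
    then obtain W h where W: "open W" "p \<in> W"
      "\<And>q. q \<in> W \<Longrightarrow> snd (coord d q) = h (snd (coord e q))"
      "\<exists>D>0. (h has_real_derivative D) (at (snd (coord e p)))"
      by blast
    then obtain D where D: "D > 0" "(h has_real_derivative D) (at (snd (coord e p)))" by blast
    note ch = is_chartD[OF chart[OF c]]
    have "((\<lambda>x. snd (trans_map c e x)) has_derivative \<alpha> e) (at (coord c p))"
      unfolding \<alpha>_def by (intro has_derivative_snd deriv e)
    moreover have "(h has_derivative (\<lambda>y. D * y)) (at (snd (trans_map c e (coord c p))))"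
      using D(2) p by (simp add: has_field_derivative_def trans_map_def ch(5))
    ultimately have "((\<lambda>x. h (snd (trans_map c e x))) has_derivative (\<lambda>v. D * \<alpha> e v)) (at (coord c p))"
      by (rule has_derivative_compose)
    then have "((\<lambda>x. snd (trans_map c d x)) has_derivative (\<lambda>v. D * \<alpha> e v)) (at (coord c p))"
    proof (rule has_derivative_transform_within_open)
      show "open (coord c ` cdom c \<inter> chart_inv c -` W)"
        by (rule continuous_open_preimage[OF ch(4,2) W(1)])
      show "coord c p \<in> coord c ` cdom c \<inter> chart_inv c -` W" using p W(2) ch(5) by simp
    qed (use W(3) in \<open>simp add: trans_map_def\<close>)
    moreover have "((\<lambda>x. snd (trans_map c d x)) has_derivative \<alpha> d) (at (coord c p))"
      unfolding \<alpha>_def by (intro has_derivative_snd deriv d)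
    ultimately have "\<alpha> d = (\<lambda>v. D * \<alpha> e v)" by (rule has_derivative_unique[rotated])
    then show ?thesis using D(1) by auto
  qed
  have t\<alpha>: "v \<in> tangent_leaf \<F> c p \<longleftrightarrow> \<alpha> e v = 0" for v
  proof -
    have "v \<in> tangent_leaf \<F> c p \<longleftrightarrow> (\<forall>d\<in>\<F>. p \<in> cdom d \<longrightarrow> \<alpha> d v = 0)"
      by (simp add: tangent_leaf_def \<alpha>_def)
    also have "\<dots> \<longleftrightarrow> \<alpha> e v = 0" using e proportional by (metis mult_zero_right)
    finally show ?thesis .
  qed
  have t\<omega>: "g c p v (N c p) = 0" if "v \<in> tangent_leaf \<F> c p" for v
    using normal c p that sym[OF c p, of v "N c p"] unfolding oriented_unit_normal_def by simp
  have "\<alpha> e v = 0" if "g c p v (N c p) = 0" for v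
  proof -
    \<comment> \<open>Subtracting \<open>r\<close> times the normal makes the vector tangent to the
      leaf. It is then orthogonal to the normal, as \<open>v\<close> is, and this forces
      \<open>r = 0\<close>.\<close>
    define r where "r = \<alpha> e v / \<alpha> e (N c p)"
    have "\<alpha> e (v - r *\<^sub>R N c p) = 0"
      using lin[OF e] \<alpha>N[OF e] by (simp add: linear_diff linear_scale r_def)
    then have "g c p (v - r *\<^sub>R N c p) (N c p) = 0" using t\<alpha> t\<omega> by blast
    then have "r = 0" using that by (simp add: g_simps[OF c p] unit[OF c p])
    then show ?thesis using \<alpha>N[OF e] by (simp add: r_def)
  qed
  then show ?thesis using t\<alpha> t\<omega> by blast
qed

text \<open>Nondegeneracy of the metric turns the eigenvalue equation into one between forms; on
  vectors orthogonal to the normal the leaf metric agrees with the metric.\<close>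

lemma curvature_eigenspace_eq:
  "curvature_eigenspace \<F> g \<Gamma> N c p k =
     pencil_kernel (b_hat g \<Gamma> N (Suc 0) c p) (g_hat g N c p) k \<inter> {v. g c p v (N c p) = 0}"
proof -
  have "weingarten g \<Gamma> N c p v = k *\<^sub>R v \<longleftrightarrow> (\<forall>w. b_hat g \<Gamma> N (Suc 0) c p v w = k * g_hat g N c p v w)"
    if "g c p v (N c p) = 0" for v
  proof -
    have "b_hat g \<Gamma> N (Suc 0) c p v w = k * g_hat g N c p v w \<longleftrightarrow>
        g c p (weingarten g \<Gamma> N c p v) w = g c p (k *\<^sub>R v) w" for w
      using that by (simp add: b_hat_weingarten[OF c p] g_hat_eq[OF c p] g_simps[OF c p])
    then show ?thesis using nondegenerate[OF c p, of "weingarten g \<Gamma> N c p v" "k *\<^sub>R v"] by metis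
  qed
  then show ?thesis unfolding curvature_eigenspace_def pencil_kernel_def tangent_leaf_eq by blast
qed

lemma dim_curvature_eigenspace:
  "dim (pencil_kernel (b_hat g \<Gamma> N (Suc 0) c p) (g_hat g N c p) k) = dim (curvature_eigenspace \<F> g \<Gamma> N c p k) + 1"
  unfolding curvature_eigenspace_eq
proof (rule dim_pencil_kernel_null_vector[where n = "N c p"])
  show "linear (\<lambda>v. g c p v (N c p))" using bil[OF c p] unfolding bilinear_def by blast
qed (use c p in \<open>simp_all add: bilinear_b_hat bilinear_g_hat b_hat_normal g_hat_normal unit\<close>)

lemma principal_curvatures_eq:
  "principal_curvatures \<F> g \<Gamma> N c p = {k. dim (pencil_kernel (b_hat g \<Gamma> N (Suc 0) c p) (g_hat g N c p) k) > 1}"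
proof -
  have "(\<exists>v\<in>S. v \<noteq> 0) \<longleftrightarrow> dim S > 0" for S :: "('e \<times> real) set"
  proof -
    have "(\<exists>v\<in>S. v \<noteq> 0) \<longleftrightarrow> \<not> S \<subseteq> {0}" by blast
    then show ?thesis by (simp only: dim_eq_0[of S, symmetric] neq0_conv)
  qed
  then show ?thesis
    unfolding principal_curvatures_def dim_curvature_eigenspace less_add_same_cancel2 by simp
qed

end

lemma power_sum_eq:
  "power_sum \<A> \<F> g \<Gamma> N i p =
    pencil_power_sum (b_hat g \<Gamma> N (Suc 0) (chart_around \<A> p) p) (g_hat g N (chart_around \<A> p) p) i"
  using chart_around[of p]
  by (simp add: power_sum_def pencil_power_sum_def Let_def principal_curvatures_eq dim_curvature_eigenspace)

end

section \<open>Evolution along the flow of the normal field\<close>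

text \<open>The time interval is compact and nondegenerate, so derivatives within it are unique. As
  \<open>C\<close> is not 0, \<open>b_hat\<close> is the time derivative of the metric divided by
  \<open>C\<close>; its symmetry, its behaviour under changes of charts and its differentiability
  are read off from this.\<close>

locale unit_field_flow =
  fixes \<A> :: "('m::{t2_space,second_countable_topology}, 'b::euclidean_space) chart set"
    and g :: "real \<Rightarrow> ('m, 'b) metric_field" and \<Gamma> :: "real \<Rightarrow> ('m, 'b) conn"
    and N :: "('m, 'b) vfield" and C a b :: real
  assumes ab: "a < b" and C: "C \<noteq> 0"
    and at_time: "\<And>t. t \<in> {a..b} \<Longrightarrow> unit_field_manifold \<A> (g t) (\<Gamma> t) N"
    and smooth: "\<And>c u v. c \<in> \<A> \<Longrightarrow>
      smooth_on ({a..b} \<times> coord c ` cdom c) (\<lambda>(t, x). g t c (chart_inv c x) u v)"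
    and flow: "\<And>t c p u v. t \<in> {a..b} \<Longrightarrow> c \<in> \<A> \<Longrightarrow> p \<in> cdom c \<Longrightarrow>
      ((\<lambda>s. g s c p u v) has_real_derivative C * b_hat (g t) (\<Gamma> t) N (Suc 0) c p u v) (at t within {a..b})"
begin

abbreviation "h t \<equiv> b_hat (g t) (\<Gamma> t) N (Suc 0)"
abbreviation "q t \<equiv> g_hat (g t) N"

lemma unique: "t \<in> {a..b} \<Longrightarrow> (f has_real_derivative D) (at t within {a..b}) \<Longrightarrow>
    (f has_real_derivative D') (at t within {a..b}) \<Longrightarrow> D = D'"
  using has_real_derivative_unique_interval[OF ab] .

lemma chart: "c \<in> \<A> \<Longrightarrow> is_chart c"
  using unit_field_manifold.chart[OF at_time[of a]] ab by simp

text \<open>The metric transforms as a tensor at every time, and the change of charts does not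
  depend on time, so the time derivative transforms in the same way.\<close>

lemma second_form_jac:
  assumes t: "t \<in> {a..b}" and cd: "c \<in> \<A>" "d \<in> \<A>" "p \<in> cdom c" "p \<in> cdom d"
  shows "h t d p (jac c d p u) (jac c d p v) = h t c p u v"
proof -
  have "((\<lambda>s. g s c p u v) has_real_derivative C * h t d p (jac c d p u) (jac c d p v)) (at t within {a..b})"
    by (rule has_real_derivative_transform[OF t _ flow[OF t cd(2,4)]])
       (rule unit_field_manifold.metric_jac[OF at_time cd])
  from unique[OF t this flow[OF t cd(1,3)]] C show ?thesis by simp
qed

context
  fixes c assumes c: "c \<in> \<A>"
begin

text \<open>The right side of the flow equation vanishes when one argument is the normal.\<close>

lemma normal_covector_constant:
  assumes t: "t \<in> {a..b}" and p: "p \<in> cdom c"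
  shows "g t c p u (N c p) = g a c p u (N c p)"
proof -
  have "((\<lambda>s. g s c p u (N c p)) has_real_derivative 0) (at s within {a..b})" if s: "s \<in> {a..b}" for s
    using flow[OF s c p, of u "N c p"] by (simp add: unit_field_manifold.b_hat_normal[OF at_time[OF s] c p])
  then have "\<exists>k. \<forall>s\<in>{a..b}. g s c p u (N c p) = k"
    by (intro has_field_derivative_zero_constant) auto
  then obtain k where "\<forall>s\<in>{a..b}. g s c p u (N c p) = k" ..
  then show ?thesis using t ab by simp
qed

lemma leaf_metric_eq:
  assumes "t \<in> {a..b}" "p \<in> cdom c"
  shows "q t c p u v = g t c p u v - g a c p u (N c p) * g a c p v (N c p)"
  using unit_field_manifold.g_hat_eq[OF at_time[OF assms(1)] c assms(2)]
  by (simp add: normal_covector_constant[OF assms])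

text \<open>Self-adjointness of the Weingarten operator is inherited from symmetry of the metric
  through the time derivative.\<close>

lemma second_form_sym:
  assumes t: "t \<in> {a..b}" and p: "p \<in> cdom c"
  shows "h t c p u v = h t c p v u"
proof -
  have "((\<lambda>s. g s c p u v) has_real_derivative C * h t c p v u) (at t within {a..b})"
    by (rule has_real_derivative_transform[OF t _ flow[OF t c p]])
       (rule unit_field_manifold.sym[OF at_time c p])
  from unique[OF t this flow[OF t c p]] C show ?thesis by simp
qed

text \<open>Symmetry halves the identity for \<open>b(u, v) + b(v, u)\<close>. Terms with the normal
  covector are frozen at time \<open>a\<close>, so that the right side depends on time only through
  the metric and the leaf metric.\<close>

lemma second_form_lie_derivative:
  assumes t: "t \<in> {a..b}" and p: "p \<in> cdom c"
  shows "h t c p u v = - (1/2) *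
    (chart_deriv c (\<lambda>r. g t c r u v) p (N c p)
     - chart_deriv c (\<lambda>r. g a c r u (N c r)) p (N c p) * g a c p v (N c p)
     - g a c p u (N c p) * chart_deriv c (\<lambda>r. g a c r v (N c r)) p (N c p)
     + q t c p (chart_deriv c (N c) p u) v + q t c p u (chart_deriv c (N c) p v))"
proof -
  have d: "chart_deriv c (\<lambda>r. g t c r w (N c r)) p z = chart_deriv c (\<lambda>r. g a c r w (N c r)) p z" for w z
    by (rule chart_deriv_cong[OF chart[OF c] p normal_covector_constant[OF t]])
  have "h t c p u v + h t c p v u = - (chart_deriv c (\<lambda>r. g t c r u v) p (N c p)
     - chart_deriv c (\<lambda>r. g a c r u (N c r)) p (N c p) * g a c p v (N c p)
     - g a c p u (N c p) * chart_deriv c (\<lambda>r. g a c r v (N c r)) p (N c p)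
     + q t c p (chart_deriv c (N c) p u) v + q t c p u (chart_deriv c (N c) p v))"
    unfolding unit_field_manifold.lie_derivative_g_hat[OF at_time[OF t] c p]
    by (simp only: d normal_covector_constant[OF t p])
  moreover have "y = - (1/2) * x" if "y + z = - x" "y = z" for x y z :: real
    using that by simp
  ultimately show ?thesis using second_form_sym[OF t p, of u v] by blast
qed

lemma leaf_metric_has_derivative:
  assumes t: "t \<in> {a..b}" and p: "p \<in> cdom c"
  shows "((\<lambda>s. q s c p u v) has_real_derivative C * h t c p u v) (at t within {a..b})"
proof (rule has_real_derivative_transform[OF t leaf_metric_eq[OF _ p]])
  show "((\<lambda>s. g s c p u v - g a c p u (N c p) * g a c p v (N c p)) has_real_derivative C * h t c p u v)
      (at t within {a..b})"
    using flow[OF t c p, of u v] by (auto intro!: derivative_eq_intros)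
qed

lemma metric_spacetime_derivative:
  obtains F' where
    "\<And>z. z \<in> {a..b} \<times> coord c ` cdom c \<Longrightarrow> ((\<lambda>z. g (fst z) c (chart_inv c (snd z)) u v) has_derivative F' z)
       (at z within {a..b} \<times> coord c ` cdom c)"
    "\<And>w. Ck_on (Suc 0) ({a..b} \<times> coord c ` cdom c) (\<lambda>z. F' z w)"
    "\<And>t p. t \<in> {a..b} \<Longrightarrow> p \<in> cdom c \<Longrightarrow> F' (t, coord c p) (1, 0) = C * h t c p u v"
    "\<And>t p w. t \<in> {a..b} \<Longrightarrow> p \<in> cdom c \<Longrightarrow>
       F' (t, coord c p) (0, w) = chart_deriv c (\<lambda>r. g t c r u v) p w"
proof -
  let ?U = "coord c ` cdom c"
  let ?S = "{a..b} \<times> ?U"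
  let ?G = "\<lambda>z. g (fst z) c (chart_inv c (snd z)) u v"
  note ch = is_chartD[OF chart[OF c]]
  have "Ck_on (Suc (Suc 0)) ?S ?G"
    using smooth[OF c, of u v] unfolding smooth_on_def split_beta by blast
  then obtain F' where F': "\<And>z. z \<in> ?S \<Longrightarrow> (?G has_derivative F' z) (at z within ?S)"
    and CF: "\<And>v. Ck_on (Suc 0) ?S (\<lambda>z. F' z v)"
    unfolding Ck_on.simps(2)[of "Suc 0"] by blast
  have Ft: "F' (t, coord c p) (1, 0) = C * h t c p u v" if t: "t \<in> {a..b}" and p: "p \<in> cdom c" for t p
  proof (rule unique[OF t _ flow[OF t c p]])
    have z: "(t, coord c p) \<in> ?S" using t p by auto
    have "((\<lambda>s. (s, coord c p)) has_derivative (\<lambda>d. (d, 0))) (at t within {a..b})"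
      by (intro has_derivative_Pair has_derivative_ident has_derivative_const)
    then have *: "((\<lambda>s. ?G (s, coord c p)) has_derivative (\<lambda>d. F' (t, coord c p) (d, 0))) (at t within {a..b})"
      by (rule has_derivative_in_compose) (rule has_derivative_subset[OF F'[OF z]], use p in auto)
    have "F' (t, coord c p) (d, 0) = F' (t, coord c p) (1, 0) * d" for d
      using linear_scale[OF has_derivative_linear[OF F'[OF z]], of d "(1, 0)"] by simp
    then have "(\<lambda>d. F' (t, coord c p) (d, 0)) = (\<lambda>d. F' (t, coord c p) (1, 0) * d)" by (rule ext)
    with * show "((\<lambda>s. g s c p u v) has_real_derivative F' (t, coord c p) (1, 0)) (at t within {a..b})"
      by (simp only: has_field_derivative_def fst_conv snd_conv ch(5)[OF p])
  qed
  have Fx: "F' (t, coord c p) (0, w) = chart_deriv c (\<lambda>r. g t c r u v) p w"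
    if t: "t \<in> {a..b}" and p: "p \<in> cdom c" for t p w
  proof -
    have z: "(t, coord c p) \<in> ?S" using that by auto
    have "((\<lambda>y. (t, y)) has_derivative (\<lambda>w. (0, w))) (at (coord c p) within ?U)"
      by (intro has_derivative_Pair has_derivative_ident has_derivative_const)
    then have "((\<lambda>y. ?G (t, y)) has_derivative (\<lambda>w. F' (t, coord c p) (0, w))) (at (coord c p) within ?U)"
      by (rule has_derivative_in_compose) (rule has_derivative_subset[OF F'[OF z]], use t in auto)
    then have "((\<lambda>y. g t c (chart_inv c y) u v) has_derivative (\<lambda>w. F' (t, coord c p) (0, w))) (at (coord c p))"
      by (simp only: at_within_open[OF imageI[OF p] ch(2)] fst_conv snd_conv)
    from fun_cong[OF chart_deriv_eqI[of "\<lambda>r. g t c r u v", OF this]] show ?thesis by simp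
  qed
  show ?thesis by (rule that[OF F' CF Ft Fx])
qed

text \<open>Up to the factor \<open>C\<close>, the second form is the time part of the spacetime
  derivative of the metric, so it is differentiable jointly in time and space. Exchanging mixed
  partials then gives the time derivative of the spatial derivatives of the metric.\<close>

lemma second_form_spacetime_derivative:
  assumes t: "t \<in> {a..b}" and p: "p \<in> cdom c"
  obtains P' where
    "((\<lambda>z. h (fst z) c (chart_inv c (snd z)) u v) has_derivative P')
       (at (t, coord c p) within {a..b} \<times> coord c ` cdom c)"
    "\<And>w. ((\<lambda>s. chart_deriv c (\<lambda>r. g s c r u v) p w) has_real_derivative C * P' (0, w)) (at t within {a..b})"
proof -
  let ?S = "{a..b} \<times> coord c ` cdom c"
  note ch = is_chartD[OF chart[OF c]]
  obtain F' where F: "\<And>z. z \<in> ?S \<Longrightarrow> ((\<lambda>z. g (fst z) c (chart_inv c (snd z)) u v) has_derivative F' z) (at z within ?S)"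
    and CF: "\<And>w. Ck_on (Suc 0) ?S (\<lambda>z. F' z w)"
    and Ft: "\<And>t p. t \<in> {a..b} \<Longrightarrow> p \<in> cdom c \<Longrightarrow> F' (t, coord c p) (1, 0) = C * h t c p u v"
    and Fx: "\<And>t p w. t \<in> {a..b} \<Longrightarrow> p \<in> cdom c \<Longrightarrow>
       F' (t, coord c p) (0, w) = chart_deriv c (\<lambda>r. g t c r u v) p w"
    using metric_spacetime_derivative[of u v] by blast
  have z: "(t, coord c p) \<in> ?S" using t p by auto
  obtain P1 where P1: "\<And>z. z \<in> ?S \<Longrightarrow> ((\<lambda>z. F' z (1, 0)) has_derivative P1 z) (at z within ?S)"
    using Ck_on_1D[OF CF[of "(1, 0)"]] by blast
  show ?thesis
  proof (rule that[of "\<lambda>w. P1 (t, coord c p) w / C"])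
    show "((\<lambda>z. h (fst z) c (chart_inv c (snd z)) u v) has_derivative (\<lambda>w. P1 (t, coord c p) w / C))
       (at (t, coord c p) within ?S)"
    proof (rule has_derivative_transform[OF z])
      show "((\<lambda>z. F' z (1, 0) / C) has_derivative (\<lambda>w. P1 (t, coord c p) w / C)) (at (t, coord c p) within ?S)"
        unfolding divide_inverse by (rule has_derivative_mult_left[OF P1[OF z]])
      show "h (fst z) c (chart_inv c (snd z)) u v = F' z (1, 0) / C" if "z \<in> ?S" for z
        using Ft[of "fst z" "chart_inv c (snd z)"] ch(6)[of "snd z"] that C by (simp add: mem_Times_iff)
    qed
    show "((\<lambda>s. chart_deriv c (\<lambda>r. g s c r u v) p w) has_real_derivative C * (P1 (t, coord c p) (0, w) / C)) (at t within {a..b})" for w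
    proof (rule has_real_derivative_transform[OF t])
      show "((\<lambda>s. F' (s, coord c p) (0, w)) has_real_derivative C * (P1 (t, coord c p) (0, w) / C)) (at t within {a..b})"
        using mixed_partials_commute[OF ab t ch(2) imageI[OF p] F CF CF P1[OF z], of w] C by simp
      show "chart_deriv c (\<lambda>r. g s c r u v) p w = F' (s, coord c p) (0, w)" if "s \<in> {a..b}" for s
        by (rule Fx[OF that p, symmetric])
    qed
  qed
qed

text \<open>The chain rule along the spacetime curve through the points
  \<open>(r, \<gamma> r)\<close>, whose velocity is \<open>(1, w)\<close>.\<close>

lemma slice_has_derivative:
  assumes P': "((\<lambda>z. k (fst z) (chart_inv c (snd z))) has_derivative P') (at (s, coord c (\<gamma> s)) within {a..b} \<times> coord c ` cdom c)"
    and S: "S \<subseteq> {a..b}" "s \<in> S" "\<And>r. r \<in> S \<Longrightarrow> \<gamma> r \<in> cdom c"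
    and \<gamma>: "((\<lambda>r. coord c (\<gamma> r)) has_vector_derivative w) (at s within S)"
  shows "((\<lambda>r. k r (\<gamma> r)) has_real_derivative P' (1, w)) (at s within S)"
proof -
  have "((\<lambda>r. (r, coord c (\<gamma> r))) has_derivative (\<lambda>d. (d, d *\<^sub>R w))) (at s within S)"
    using \<gamma> by (intro has_derivative_Pair has_derivative_ident) (simp add: has_vector_derivative_def)
  then have *: "((\<lambda>r. k (fst (r, coord c (\<gamma> r))) (chart_inv c (snd (r, coord c (\<gamma> r)))))
      has_derivative (\<lambda>d. P' (d, d *\<^sub>R w))) (at s within S)"
    by (rule has_derivative_in_compose) (rule has_derivative_subset[OF P'], use S in auto)
  have "P' (d, d *\<^sub>R w) = P' (1, w) * d" for d
    using linear_scale[OF has_derivative_linear[OF P'], of d "(1, w)"] by simp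
  then have "(\<lambda>d. P' (d, d *\<^sub>R w)) = (\<lambda>d. P' (1, w) * d)" by (rule ext)
  with * have **: "((\<lambda>r. k r (chart_inv c (coord c (\<gamma> r)))) has_real_derivative P' (1, w)) (at s within S)"
    by (simp only: has_field_derivative_def fst_conv snd_conv)
  show ?thesis
    by (rule has_real_derivative_transform[OF S(2) _ **]) (simp add: is_chartD(5)[OF chart[OF c] S(3)])
qed

section \<open>Evolution along curves with velocity \<open>(C / 2) N\<close>\<close>

context
  fixes \<gamma> :: "real \<Rightarrow> 'm" and S s
  assumes S: "S \<subseteq> {a..b}" "s \<in> S" "\<And>r. r \<in> S \<Longrightarrow> \<gamma> r \<in> cdom c"
    and \<gamma>: "((\<lambda>r. coord c (\<gamma> r)) has_vector_derivative (C / 2) *\<^sub>R N c (\<gamma> s)) (at s within S)"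
begin

text \<open>Differentiating the Lie derivative formula in time expresses the partial time derivative
  of \<open>h\<close> by the same formula with \<open>h\<close> in place of the leaf metric. Adding
  the transport term \<open>(C / 2)\<close> times the derivative along the normal cancels the
  spatial derivative of \<open>h\<close>.\<close>

lemma second_form_along_curve:
  "((\<lambda>r. h r c (\<gamma> r) u v) has_real_derivative - (C / 2) *
    (h s c (\<gamma> s) (chart_deriv c (N c) (\<gamma> s) u) v + h s c (\<gamma> s) u (chart_deriv c (N c) (\<gamma> s) v))) (at s within S)"
proof -
  have s: "s \<in> {a..b}" and p: "\<gamma> s \<in> cdom c" using S by auto
  let ?p = "\<gamma> s"
  let ?d = "chart_deriv c (N c) ?p"
  obtain P' where
    P: "((\<lambda>z. h (fst z) c (chart_inv c (snd z)) u v) has_derivative P')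
       (at (s, coord c ?p) within {a..b} \<times> coord c ` cdom c)"
    and M: "\<And>w. ((\<lambda>r. chart_deriv c (\<lambda>q. g r c q u v) ?p w) has_real_derivative C * P' (0, w)) (at s within {a..b})"
    using second_form_spacetime_derivative[OF s p, of u v] by blast
  have lin: "linear P'" by (rule has_derivative_linear[OF P])
  \<comment> \<open>A constant curve isolates the partial derivative in time.\<close>
  have "((\<lambda>r. h r c ?p u v) has_real_derivative P' (1, 0)) (at s within {a..b})"
    using slice_has_derivative[where k = "\<lambda>r x. h r c x u v" and \<gamma> = "\<lambda>_. ?p" and w = 0, OF P order_refl s p] by simp
  moreover have "((\<lambda>r. h r c ?p u v) has_real_derivative
      - (1/2) * (C * P' (0, N c ?p) + C * h s c ?p (?d u) v + C * h s c ?p u (?d v))) (at s within {a..b})"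
  proof (rule has_real_derivative_transform[OF s second_form_lie_derivative[OF _ p]])
    show "((\<lambda>r. - (1/2) * (chart_deriv c (\<lambda>q. g r c q u v) ?p (N c ?p)
       - chart_deriv c (\<lambda>r. g a c r u (N c r)) ?p (N c ?p) * g a c ?p v (N c ?p)
       - g a c ?p u (N c ?p) * chart_deriv c (\<lambda>r. g a c r v (N c r)) ?p (N c ?p)
       + q r c ?p (?d u) v + q r c ?p u (?d v))) has_real_derivative
      - (1/2) * (C * P' (0, N c ?p) + C * h s c ?p (?d u) v + C * h s c ?p u (?d v))) (at s within {a..b})"
      by (auto intro!: derivative_eq_intros M leaf_metric_has_derivative s p)
  qed
  ultimately have 1: "P' (1, 0) = - (1/2) * (C * P' (0, N c ?p) + C * h s c ?p (?d u) v + C * h s c ?p u (?d v))"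
    by (rule unique[OF s])
  have "P' (1, (C / 2) *\<^sub>R N c ?p) = P' (1, 0) + (C / 2) * P' (0, N c ?p)"
    using linear_add[OF lin, of "(1, 0)" "(C / 2) *\<^sub>R (0, N c ?p)"] linear_scale[OF lin, of "C / 2" "(0, N c ?p)"] by simp
  also have "\<dots> = - (C / 2) * (h s c ?p (?d u) v + h s c ?p u (?d v))"
    unfolding 1 by (simp add: algebra_simps)
  finally show ?thesis using slice_has_derivative[where k = "\<lambda>r x. h r c x u v", OF P S \<gamma>] by simp
qed

text \<open>The leaf metric is the metric minus a product of normal covectors, which change only
  through the position on the curve. Inserting the Lie derivative formula for the term
  \<open>C h\<close> cancels all derivatives except those of the normal.\<close>

lemma leaf_metric_along_curve:
  "((\<lambda>r. q r c (\<gamma> r) u v) has_real_derivative - (C / 2) *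
    (q s c (\<gamma> s) (chart_deriv c (N c) (\<gamma> s) u) v + q s c (\<gamma> s) u (chart_deriv c (N c) (\<gamma> s) v))) (at s within S)"
proof -
  have s: "s \<in> {a..b}" and p: "\<gamma> s \<in> cdom c" using S by auto
  let ?p = "\<gamma> s"
  let ?n = "(C / 2) *\<^sub>R N c ?p"
  have aa: "a \<in> {a..b}" using ab by simp
  \<comment> \<open>Time \<open>a\<close> serves as the reference time at which the normal covector
    is frozen.\<close>
  interpret a: unit_field_manifold \<A> "g a" "\<Gamma> a" N by (rule at_time[OF aa])
  obtain F' where F: "\<And>z. z \<in> {a..b} \<times> coord c ` cdom c \<Longrightarrow>
      ((\<lambda>z. g (fst z) c (chart_inv c (snd z)) u v) has_derivative F' z) (at z within {a..b} \<times> coord c ` cdom c)"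
    and "\<And>w. Ck_on (Suc 0) ({a..b} \<times> coord c ` cdom c) (\<lambda>z. F' z w)"
    and Ft: "\<And>t p. t \<in> {a..b} \<Longrightarrow> p \<in> cdom c \<Longrightarrow> F' (t, coord c p) (1, 0) = C * h t c p u v"
    and Fx: "\<And>t p w. t \<in> {a..b} \<Longrightarrow> p \<in> cdom c \<Longrightarrow>
       F' (t, coord c p) (0, w) = chart_deriv c (\<lambda>r. g t c r u v) p w"
    using metric_spacetime_derivative[of u v] by blast
  define G' where "G' = F' (s, coord c ?p)"
  have G: "((\<lambda>z. g (fst z) c (chart_inv c (snd z)) u v) has_derivative G')
       (at (s, coord c ?p) within {a..b} \<times> coord c ` cdom c)"
    unfolding G'_def by (rule F) (use s p in auto)
  have G1: "G' (1, 0) = C * h s c ?p u v" and G2: "\<And>w. G' (0, w) = chart_deriv c (\<lambda>r. g s c r u v) ?p w"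
    unfolding G'_def by (rule Ft[OF s p], rule Fx[OF s p])
  have lin: "linear G'" by (rule has_derivative_linear[OF G])
  have "G' (1, ?n) = G' (1, 0) + (C / 2) * G' (0, N c ?p)"
    using linear_add[OF lin, of "(1, 0)" "(C / 2) *\<^sub>R (0, N c ?p)"] linear_scale[OF lin, of "C / 2" "(0, N c ?p)"] by simp
  then have g: "((\<lambda>r. g r c (\<gamma> r) u v) has_real_derivative
      C * h s c ?p u v + (C / 2) * chart_deriv c (\<lambda>r. g s c r u v) ?p (N c ?p)) (at s within S)"
    using slice_has_derivative[where k = "\<lambda>r x. g r c x u v", OF G S \<gamma>] G1 G2 by simp
  have \<omega>: "((\<lambda>r. g a c (\<gamma> r) w (N c (\<gamma> r))) has_real_derivative
      (C / 2) * chart_deriv c (\<lambda>r. g a c r w (N c r)) ?p (N c ?p)) (at s within S)" for w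
  proof -
    have "((\<lambda>x. g a c (chart_inv c x) w (N c (chart_inv c x))) has_derivative
        chart_deriv c (\<lambda>r. g a c r w (N c r)) ?p) (at (coord c ?p))"
      by (rule a.normal_covector_has_derivative[OF c p])
    moreover note \<gamma>
    ultimately have "((\<lambda>r. g a c (chart_inv c (coord c (\<gamma> r))) w (N c (chart_inv c (coord c (\<gamma> r))))) has_vector_derivative
        chart_deriv c (\<lambda>r. g a c r w (N c r)) ?p ?n) (at s within S)"
      using vector_derivative_diff_chain_within[OF \<gamma> has_derivative_at_withinI] by (simp add: o_def)
    moreover have "linear (chart_deriv c (\<lambda>r. g a c r w (N c r)) ?p)"
      by (rule has_derivative_linear[OF a.normal_covector_has_derivative[OF c p]])
    ultimately have "((\<lambda>r. g a c (chart_inv c (coord c (\<gamma> r))) w (N c (chart_inv c (coord c (\<gamma> r))))) has_real_derivative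
        (C / 2) * chart_deriv c (\<lambda>r. g a c r w (N c r)) ?p (N c ?p)) (at s within S)"
      by (simp add: has_real_derivative_iff_has_vector_derivative linear_scale)
    then show ?thesis
      by (rule has_real_derivative_transform[OF S(2), rotated]) (simp add: is_chartD(5)[OF chart[OF c] S(3)])
  qed
  have 1: "((\<lambda>r. g r c (\<gamma> r) u v - g a c (\<gamma> r) u (N c (\<gamma> r)) * g a c (\<gamma> r) v (N c (\<gamma> r))) has_real_derivative
     C * h s c ?p u v + (C / 2) * chart_deriv c (\<lambda>r. g s c r u v) ?p (N c ?p)
     - ((C / 2) * chart_deriv c (\<lambda>r. g a c r u (N c r)) ?p (N c ?p) * g a c ?p v (N c ?p)
      + (C / 2) * chart_deriv c (\<lambda>r. g a c r v (N c r)) ?p (N c ?p) * g a c ?p u (N c ?p))) (at s within S)"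
    by (intro DERIV_diff DERIV_mult g \<omega>)
  have "((\<lambda>r. q r c (\<gamma> r) u v) has_real_derivative
     C * h s c ?p u v + (C / 2) * chart_deriv c (\<lambda>r. g s c r u v) ?p (N c ?p)
     - ((C / 2) * chart_deriv c (\<lambda>r. g a c r u (N c r)) ?p (N c ?p) * g a c ?p v (N c ?p)
      + (C / 2) * chart_deriv c (\<lambda>r. g a c r v (N c r)) ?p (N c ?p) * g a c ?p u (N c ?p))) (at s within S)"
    by (rule has_real_derivative_transform[OF S(2) _ 1]) (rule leaf_metric_eq, use S in auto)
  then show ?thesis
    unfolding second_form_lie_derivative[OF s p] by (rule DERIV_cong) (simp add: algebra_simps)
qed

end

end

end

text \<open>In the product rule, the change of the form cancels the changes of its arguments, which
  solve the linearized equation of the curve.\<close>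

lemma bilinear_family_transport_constant:
  fixes k :: "real \<Rightarrow> 'a::euclidean_space \<Rightarrow> 'a \<Rightarrow> real"
  assumes S: "convex S" "s \<in> S" "s' \<in> S"
    and bil: "\<And>r. r \<in> S \<Longrightarrow> bilinear (k r)" and D: "\<And>r. r \<in> S \<Longrightarrow> linear (D r)"
    and k: "\<And>r u v. r \<in> S \<Longrightarrow>
      ((\<lambda>r. k r u v) has_real_derivative - c * (k r (D r u) v + k r u (D r v))) (at r within S)"
    and U: "\<And>r. r \<in> S \<Longrightarrow> (U has_vector_derivative c *\<^sub>R D r (U r)) (at r within S)"
    and V: "\<And>r. r \<in> S \<Longrightarrow> (V has_vector_derivative c *\<^sub>R D r (V r)) (at r within S)"
  shows "k s (U s) (V s) = k s' (U s') (V s')"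
proof -
  have "((\<lambda>r. k r (U r) (V r)) has_real_derivative 0) (at r within S)" if r: "r \<in> S" for r
  proof -
    note b = bil[OF r]
    have "bilinear (\<lambda>u v. - c * (k r (D r u) v + k r u (D r v)))"
      unfolding bilinear_def
      by (intro conjI allI linearI) (simp_all add: bilinear_ladd[OF b] bilinear_radd[OF b] bilinear_lmul[OF b]
          bilinear_rmul[OF b] linear_add[OF D[OF r]] linear_scale[OF D[OF r]] algebra_simps)
    from has_real_derivative_bilinear_family[OF bil r k[OF r] this U[OF r] V[OF r]]
    show ?thesis by (simp add: bilinear_lmul[OF b] bilinear_rmul[OF b] algebra_simps)
  qed
  then have "\<exists>z. \<forall>r\<in>S. k r (U r) (V r) = z"
    by (intro has_field_derivative_zero_constant S(1))
  then show ?thesis using S(2,3) by auto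
qed

section \<open>Constancy of the power sums along integral curves\<close>

context unit_field_flow
begin

definition spectrum_sum :: "nat \<Rightarrow> real \<Rightarrow> ('m, 'b) chart \<Rightarrow> 'm \<Rightarrow> real" where
  "spectrum_sum i t c p = pencil_power_sum (h t c p) (q t c p) i"

text \<open>The Jacobian of the change of charts is a congruence of both forms.\<close>

lemma spectrum_sum_chart:
  assumes t: "t \<in> {a..b}" and cd: "c \<in> \<A>" "d \<in> \<A>" "p \<in> cdom c" "p \<in> cdom d"
  shows "spectrum_sum i t d p = spectrum_sum i t c p"
  unfolding spectrum_sum_def
  using second_form_jac[OF t cd] unit_field_manifold.g_hat_jac[OF at_time[OF t] cd]
  by (intro pencil_power_sum_congruence[where \<Psi> = "jac c d p"]
      unit_field_manifold.jac_injective[OF at_time[OF t] cd]) simp_all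

text \<open>An injective solution \<open>\<Phi>\<close> of the linearized equation along the curve
  stands in for the differential of the flow. Pulled back by it, both forms are independent of time,
  and a congruence preserves the power sums.\<close>

lemma spectrum_sum_locally_constant:
  assumes c: "c \<in> \<A>" and J: "open J" "s0 \<in> J" "s0 \<in> {a..b}"
    and \<gamma>: "\<And>s. s \<in> J \<Longrightarrow> \<gamma> s \<in> cdom c"
    and \<gamma>': "\<And>s. s \<in> J \<Longrightarrow>
      ((\<lambda>r. coord c (\<gamma> r)) has_vector_derivative (C / 2) *\<^sub>R N c (\<gamma> s)) (at s)"
  obtains \<delta> where "\<delta> > 0"
    "\<And>s. s \<in> {a..b} \<Longrightarrow> \<bar>s - s0\<bar> < \<delta> \<Longrightarrow>
       s \<in> J \<and> spectrum_sum i s c (\<gamma> s) = spectrum_sum i s0 c (\<gamma> s0)"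
proof -
  interpret m: unit_field_manifold \<A> "g s0" "\<Gamma> s0" N by (rule at_time[OF J(3)])
  note ch = is_chartD[OF chart[OF c]]
  let ?D = "\<lambda>s. chart_deriv c (N c) (\<gamma> s)"
  obtain e where e: "e > 0" "cball s0 e \<subseteq> J" using J(1,2) open_contains_cball by blast
  have eJ: "{s0 - e..s0 + e} \<subseteq> J" using e(2) by (auto simp: cball_eq_atLeastAtMost)
  define L where "L s = Blinfun (\<lambda>u. (C / 2) *\<^sub>R ?D s u)" for s
  have linD: "linear (?D s)" if "s \<in> J" for s
    by (rule m.linear_chart_deriv_normal[OF c \<gamma>[OF that]])
  have L: "blinfun_apply (L s) u = (C / 2) *\<^sub>R ?D s u" if "s \<in> J" for s u
    unfolding L_def
    by (subst bounded_linear_Blinfun_apply)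
       (use linD[OF that] in \<open>auto intro!: bounded_linear_scaleR_right bounded_linear_compose[OF bounded_linear_scaleR_right] simp: linear_conv_bounded_linear\<close>)
  have cont\<gamma>: "continuous_on J (\<lambda>s. coord c (\<gamma> s))"
    by (rule continuous_at_imp_continuous_on) (use \<gamma>' has_vector_derivative_continuous in blast)
  have contL: "continuous_on J L"
  proof (rule continuous_on_blinfun_componentwise)
    fix u :: 'b
    have "continuous_on (coord c ` cdom c) (\<lambda>x. frechet_derivative (\<lambda>x. N c (chart_inv c x)) (at x) u)"
      using m.smooth_normal[OF c \<gamma>[OF J(2)]] ch(2)
      by (intro smooth_on_open_continuous_derivative) (simp_all add: smooth_in_chart_def)
    then have "continuous_on J (\<lambda>s. frechet_derivative (\<lambda>x. N c (chart_inv c x)) (at (coord c (\<gamma> s))) u)"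
      by (rule continuous_on_compose2[OF _ cont\<gamma>]) (use \<gamma> in auto)
    then have "continuous_on J (\<lambda>s. (C / 2) *\<^sub>R ?D s u)"
      unfolding chart_deriv_def by (intro continuous_intros)
    then show "continuous_on J (\<lambda>s. blinfun_apply (L s) u)"
      by (rule continuous_on_eq) (simp add: L)
  qed
  have "compact (L ` {s0 - e..s0 + e})"
    by (intro compact_continuous_image continuous_on_subset[OF contL eJ]) simp
  then have "bounded (L ` {s0 - e..s0 + e})" by (rule compact_imp_bounded)
  then obtain B where B: "B > 0" "\<And>s. s \<in> {s0 - e..s0 + e} \<Longrightarrow> norm (L s) \<le> B"
    unfolding bounded_pos by blast
  \<comment> \<open>The interval around \<open>s0\<close> has length twice \<open>\<delta>\<close>,
    so \<open>1 / (8 * B)\<close> meets the bound 1/4 required for solving the linear equation; the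
    bound by \<open>e\<close> keeps the interval inside \<open>J\<close>.\<close>
  define \<delta> where "\<delta> = min e (1 / (8 * B))"
  have \<delta>: "\<delta> > 0" "\<delta> \<le> e" using e B by (auto simp: \<delta>_def)
  have sub: "{s0 - \<delta>..s0 + \<delta>} \<subseteq> {s0 - e..s0 + e}" using \<delta> by auto
  have small: "B * ((s0 + \<delta>) - (s0 - \<delta>)) \<le> 1/4"
  proof -
    have "B * \<delta> \<le> B * (1 / (8 * B))" using B(1) by (intro mult_left_mono) (auto simp: \<delta>_def)
    then show ?thesis using B(1) by simp
  qed
  have "\<exists>\<Phi> :: real \<Rightarrow> 'b \<Rightarrow>\<^sub>L 'b. \<forall>s\<in>{s0 - \<delta>..s0 + \<delta>}.
      (\<Phi> has_vector_derivative L s o\<^sub>L \<Phi> s) (at s within {s0 - \<delta>..s0 + \<delta>}) \<and> inj (blinfun_apply (\<Phi> s))"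
  proof (rule linear_ode_exists[OF _ _ _ small])
    show "s0 - \<delta> \<le> s0 + \<delta>" using \<delta> by simp
    show "continuous_on {s0 - \<delta>..s0 + \<delta>} L" using contL continuous_on_subset sub eJ by blast
    show "norm (L s) \<le> B" if "s \<in> {s0 - \<delta>..s0 + \<delta>}" for s using that sub B(2) by blast
  qed
  then obtain \<Phi> :: "real \<Rightarrow> 'b \<Rightarrow>\<^sub>L 'b" where \<Phi>: "\<And>s. s \<in> {s0 - \<delta>..s0 + \<delta>} \<Longrightarrow>
        (\<Phi> has_vector_derivative L s o\<^sub>L \<Phi> s) (at s within {s0 - \<delta>..s0 + \<delta>})"
    and inj: "\<And>s. s \<in> {s0 - \<delta>..s0 + \<delta>} \<Longrightarrow> inj (blinfun_apply (\<Phi> s))"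
    by blast
  \<comment> \<open>The evolution of the forms is known only within \<open>{a..b}\<close>, with
    one-sided derivatives if \<open>s0\<close> is an endpoint.\<close>
  define S where "S = {s0 - \<delta>..s0 + \<delta>} \<inter> {a..b}"
  have S: "S \<subseteq> {a..b}" "S \<subseteq> {s0 - \<delta>..s0 + \<delta>}" "S \<subseteq> J" "s0 \<in> S" "convex S"
    using \<delta> J sub eJ by (auto simp: S_def intro: convex_Int)
  have U: "((\<lambda>r. blinfun_apply (\<Phi> r) u) has_vector_derivative (C / 2) *\<^sub>R ?D s (blinfun_apply (\<Phi> s) u)) (at s within S)"
    if s: "s \<in> S" for s u
  proof -
    have "(\<Phi> has_vector_derivative L s o\<^sub>L \<Phi> s) (at s within S)"
      using \<Phi>[of s] S(2) s has_vector_derivative_within_subset by blast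
    from bounded_linear.has_vector_derivative[OF blinfun.bounded_linear_left this, of u]
    show ?thesis using L[of s "blinfun_apply (\<Phi> s) u"] S(3) s by auto
  qed
  have along: "((\<lambda>r. coord c (\<gamma> r)) has_vector_derivative (C / 2) *\<^sub>R N c (\<gamma> s)) (at s within S)" if "s \<in> S" for s
    using \<gamma>' S(3) that has_vector_derivative_at_within by blast
  have \<gamma>S: "\<gamma> r \<in> cdom c" if "r \<in> S" for r using \<gamma> S(3) that by blast
  have linS: "linear (?D r)" if "r \<in> S" for r using linD S(3) that by blast
  have hS: "h s c (\<gamma> s) (blinfun_apply (\<Phi> s) u) (blinfun_apply (\<Phi> s) v)
      = h s0 c (\<gamma> s0) (blinfun_apply (\<Phi> s0) u) (blinfun_apply (\<Phi> s0) v)" if s: "s \<in> S" for s u v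
  proof (rule bilinear_family_transport_constant[where k = "\<lambda>r. h r c (\<gamma> r)" and D = ?D and c = "C / 2",
        OF S(5) s S(4) _ linS _ U U])
    show "bilinear (h r c (\<gamma> r))" if "r \<in> S" for r
      by (rule unit_field_manifold.bilinear_b_hat[OF at_time c \<gamma>S[OF that]]) (use that S(1) in auto)
    show "((\<lambda>r. h r c (\<gamma> r) u v) has_real_derivative - (C / 2) * (h r c (\<gamma> r) (?D r u) v + h r c (\<gamma> r) u (?D r v)))
        (at r within S)" if "r \<in> S" for r u v
      by (rule second_form_along_curve[OF c S(1) that \<gamma>S along[OF that]])
  qed
  have qS: "q s c (\<gamma> s) (blinfun_apply (\<Phi> s) u) (blinfun_apply (\<Phi> s) v)
      = q s0 c (\<gamma> s0) (blinfun_apply (\<Phi> s0) u) (blinfun_apply (\<Phi> s0) v)" if s: "s \<in> S" for s u v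
  proof (rule bilinear_family_transport_constant[where k = "\<lambda>r. q r c (\<gamma> r)" and D = ?D and c = "C / 2",
        OF S(5) s S(4) _ linS _ U U])
    show "bilinear (q r c (\<gamma> r))" if "r \<in> S" for r
      by (rule unit_field_manifold.bilinear_g_hat[OF at_time c \<gamma>S[OF that]]) (use that S(1) in auto)
    show "((\<lambda>r. q r c (\<gamma> r) u v) has_real_derivative - (C / 2) * (q r c (\<gamma> r) (?D r u) v + q r c (\<gamma> r) u (?D r v)))
        (at r within S)" if "r \<in> S" for r u v
      by (rule leaf_metric_along_curve[OF c S(1) that \<gamma>S along[OF that]])
  qed
  have pull: "pencil_power_sum (h s c (\<gamma> s)) (q s c (\<gamma> s)) i =
      pencil_power_sum (\<lambda>u v. h s c (\<gamma> s) (blinfun_apply (\<Phi> s) u) (blinfun_apply (\<Phi> s) v))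
        (\<lambda>u v. q s c (\<gamma> s) (blinfun_apply (\<Phi> s) u) (blinfun_apply (\<Phi> s) v)) i" if "s \<in> S" for s
    by (rule pencil_power_sum_congruence[where \<Psi> = "blinfun_apply (\<Phi> s)"])
       (use that inj S(2) in \<open>auto simp: blinfun.bounded_linear_right bounded_linear.linear\<close>)
  show ?thesis
  proof (rule that[OF \<delta>(1)])
    fix s assume "s \<in> {a..b}" "\<bar>s - s0\<bar> < \<delta>"
    then have s: "s \<in> S" by (auto simp: S_def)
    show "s \<in> J \<and> spectrum_sum i s c (\<gamma> s) = spectrum_sum i s0 c (\<gamma> s0)"
      unfolding spectrum_sum_def pull[OF s] pull[OF S(4)] hS[OF s] qS[OF s] using S(3) s by blast
  qed
qed

text \<open>The points \<open>(\<gamma> (s - e), s)\<close> form an integral curve in spacetime.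
  Local constancy suffices because the time interval is connected; independence of the chart allows
  a different chart at every point.\<close>

lemma spectrum_sum_constant:
  assumes curve: "integral_curve \<A> (scale_field (C / 2) N) I \<gamma>"
    and I: "\<And>s. s \<in> {a..b} \<Longrightarrow> s - e \<in> I" and s: "s \<in> {a..b}" "s' \<in> {a..b}"
  shows "spectrum_sum i s (chart_around \<A> (\<gamma> (s - e))) (\<gamma> (s - e)) =
    spectrum_sum i s' (chart_around \<A> (\<gamma> (s' - e))) (\<gamma> (s' - e))"
proof (rule connected_local_const[where A = "{a..b}" and
      f = "\<lambda>s. spectrum_sum i s (chart_around \<A> (\<gamma> (s - e))) (\<gamma> (s - e))"])
  have I_open: "open I" and \<gamma>: "continuous_on I \<gamma>"
    using curve by (auto simp: integral_curve_def)
  show "\<forall>s\<in>{a..b}. \<forall>\<^sub>F r in at s within {a..b}.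
      spectrum_sum i s (chart_around \<A> (\<gamma> (s - e))) (\<gamma> (s - e)) =
      spectrum_sum i r (chart_around \<A> (\<gamma> (r - e))) (\<gamma> (r - e))"
  proof
    fix s0 assume s0: "s0 \<in> {a..b}"
    interpret m: unit_field_manifold \<A> "g s0" "\<Gamma> s0" N by (rule at_time[OF s0])
    define c where "c = chart_around \<A> (\<gamma> (s0 - e))"
    have c: "c \<in> \<A>" "\<gamma> (s0 - e) \<in> cdom c" using m.chart_around by (auto simp: c_def)
    \<comment> \<open>Times at which the shifted curve lies in the chart chosen at
      \<open>s0\<close>; this set is open.\<close>
    define J where "J = (\<lambda>s. s - e) -` (I \<inter> \<gamma> -` cdom c)"
    have J: "open J"
      unfolding J_def
      by (intro open_vimage continuous_open_preimage \<gamma> I_open is_chartD(1)[OF chart[OF c(1)]])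
         (auto intro!: continuous_intros)
    have s0J: "s0 \<in> J" using I[OF s0] c by (simp add: J_def)
    have \<gamma>': "((\<lambda>r. coord c (\<gamma> (r - e))) has_vector_derivative (C / 2) *\<^sub>R N c (\<gamma> (s - e))) (at s)" if "s \<in> J" for s
    proof -
      have "((\<lambda>r. coord c (\<gamma> r)) has_vector_derivative (C / 2) *\<^sub>R N c (\<gamma> (s - e))) (at (s - e))"
        using curve that c(1) by (simp add: J_def integral_curve_def scale_field_def)
      moreover have "((\<lambda>r. r - e) has_vector_derivative 1) (at s)"
        by (auto intro!: derivative_eq_intros)
      ultimately show ?thesis using vector_diff_chain_at[of "\<lambda>r. r - e" 1 s] by (simp add: o_def)
    qed
    obtain \<delta> where \<delta>: "\<delta> > 0" "\<And>s. s \<in> {a..b} \<Longrightarrow> \<bar>s - s0\<bar> < \<delta> \<Longrightarrow>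
        s \<in> J \<and> spectrum_sum i s c (\<gamma> (s - e)) = spectrum_sum i s0 c (\<gamma> (s0 - e))"
      using spectrum_sum_locally_constant[OF c(1) J s0J s0, of "\<lambda>s. \<gamma> (s - e)" i] \<gamma>' by (auto simp: J_def)
    show "\<forall>\<^sub>F r in at s0 within {a..b}.
      spectrum_sum i s0 (chart_around \<A> (\<gamma> (s0 - e))) (\<gamma> (s0 - e)) =
      spectrum_sum i r (chart_around \<A> (\<gamma> (r - e))) (\<gamma> (r - e))"
      unfolding eventually_at
    proof (intro exI conjI ballI impI)
      fix r assume r: "r \<in> {a..b}" "r \<noteq> s0 \<and> dist r s0 < \<delta>"
      then have rJ: "r \<in> J" "spectrum_sum i r c (\<gamma> (r - e)) = spectrum_sum i s0 c (\<gamma> (s0 - e))"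
        using \<delta>(2) by (auto simp: dist_real_def)
      have "spectrum_sum i r (chart_around \<A> (\<gamma> (r - e))) (\<gamma> (r - e)) = spectrum_sum i r c (\<gamma> (r - e))"
        by (rule spectrum_sum_chart[OF r(1) c(1)]) (use m.chart_around rJ(1) in \<open>auto simp: J_def\<close>)
      then show "spectrum_sum i s0 (chart_around \<A> (\<gamma> (s0 - e))) (\<gamma> (s0 - e)) =
        spectrum_sum i r (chart_around \<A> (\<gamma> (r - e))) (\<gamma> (r - e))"
        using rJ(2) by (simp add: c_def)
    qed (rule \<delta>(1))
  qed
qed (use s in auto)

end

section \<open>Power sums of the principal curvatures\<close>

text \<open>By Koszul's formula and nondegeneracy, metrics that agree on all chart domains have the
  same Christoffel maps there, hence the same Weingarten operator.\<close>

lemma unit_field_manifold_cong_metric: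
  assumes m: "unit_field_manifold \<A> g \<Gamma> N" "unit_field_manifold \<A> g' \<Gamma>' N"
    and eq: "\<And>c p u v. c \<in> \<A> \<Longrightarrow> p \<in> cdom c \<Longrightarrow> g c p u v = g' c p u v"
    and c: "c \<in> \<A>" "p \<in> cdom c"
  shows "weingarten g \<Gamma> N c p = weingarten g' \<Gamma>' N c p"
proof -
  interpret m: unit_field_manifold \<A> g \<Gamma> N by fact
  interpret m': unit_field_manifold \<A> g' \<Gamma>' N by fact
  have d: "chart_deriv c (\<lambda>q. g c q u v) p w = chart_deriv c (\<lambda>q. g' c q u v) p w" for u v w
    by (rule chart_deriv_cong[OF m.chart[OF c(1)] c(2) eq[OF c(1)]])
  have "g c p (\<Gamma> c p u v) w = g c p (\<Gamma>' c p u v) w" for u v w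
    using m.koszul[OF c, of u v w] m'.koszul[OF c, of u v w] eq[OF c] by (simp add: d)
  then have "\<Gamma> c p u v = \<Gamma>' c p u v" for u v
    by (rule m.nondegenerate[OF c])
  then show ?thesis
    by (simp add: weingarten_def[abs_def] cov_deriv_def leaf_part_def eq[OF c])
qed

lemma power_sum_cong_weingarten:
  assumes "weingarten g \<Gamma> N (chart_around \<A> p) p = weingarten g' \<Gamma>' N (chart_around \<A> p) p"
  shows "power_sum \<A> \<F> g \<Gamma> N i p = power_sum \<A> \<F> g' \<Gamma>' N i p"
  using assms by (simp add: power_sum_def principal_curvatures_def curvature_eigenspace_def Let_def)

text \<open>An integral curve in spacetime splits: its first component is an integral curve of
  \<open>X\<close>, and its second has derivative 1 on an interval, so it is the parameter plus a
  constant.\<close>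

lemma is_flow_time_plus_field:
  assumes cover: "(\<Union>c\<in>\<A>. cdom c) = UNIV" and psi: "is_flow \<A> X \<psi>"
    and phi: "\<And>r p s. \<phi> r (p, s) = (\<psi> r p, r + s)"
  shows "is_flow (time_atlas \<A>) (time_plus_field X) \<phi>"
  unfolding is_flow_def
proof (intro allI impI ballI, elim conjE)
  fix I :: "real set" and \<gamma> r
  assume curve: "integral_curve (time_atlas \<A>) (time_plus_field X) I \<gamma>" and I0: "0 \<in> I" and r: "r \<in> I"
  have I: "open I" "is_interval I" "continuous_on I \<gamma>"
    using curve by (auto simp: integral_curve_def)
  have deriv: "((\<lambda>s. (coord c (fst (\<gamma> s)), snd (\<gamma> s))) has_vector_derivative (X c (fst (\<gamma> s)), 1)) (at s)"
    if "s \<in> I" "c \<in> \<A>" "fst (\<gamma> s) \<in> cdom c" for s c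
  proof -
    have "\<gamma> s \<in> cdom (time_chart c)" using that by (simp add: time_chart_def mem_Times_iff)
    then have "((\<lambda>s. coord (time_chart c) (\<gamma> s)) has_vector_derivative time_plus_field X (time_chart c) (\<gamma> s)) (at s)"
      using curve that unfolding integral_curve_def time_atlas_def by blast
    moreover have "time_plus_field X (time_chart c) (\<gamma> s) = (X c (fst (\<gamma> s)), 1)"
      by (simp add: time_plus_field_def)
    ultimately show ?thesis by (simp add: time_chart_def split_beta)
  qed
  have "integral_curve \<A> X I (\<lambda>s. fst (\<gamma> s))"
    unfolding integral_curve_def
  proof (intro conjI ballI impI I continuous_on_fst)
    fix s c assume "s \<in> I" "c \<in> \<A>" "fst (\<gamma> s) \<in> cdom c"
    from bounded_linear.has_vector_derivative[OF bounded_linear_fst deriv[OF this]]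
    show "((\<lambda>s. coord c (fst (\<gamma> s))) has_vector_derivative X c (fst (\<gamma> s))) (at s)" by simp
  qed
  then have 1: "\<psi> r (fst (\<gamma> 0)) = fst (\<gamma> r)"
    using psi I0 r by (auto simp: is_flow_def)
  have "((\<lambda>s. snd (\<gamma> s) - s) has_real_derivative 0) (at s within I)" if s: "s \<in> I" for s
  proof -
    obtain c where "c \<in> \<A>" "fst (\<gamma> s) \<in> cdom c" using cover by blast
    from bounded_linear.has_vector_derivative[OF bounded_linear_snd deriv[OF s this]]
    have "((\<lambda>s. snd (\<gamma> s)) has_real_derivative 1) (at s within I)"
      by (simp add: has_real_derivative_iff_has_vector_derivative has_vector_derivative_at_within)
    from DERIV_diff[OF this DERIV_ident] show ?thesis by simp
  qed
  then have "\<exists>k. \<forall>s\<in>I. snd (\<gamma> s) - s = k"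
    by (intro has_field_derivative_zero_constant is_interval_convex I)
  then have "snd (\<gamma> r) - r = snd (\<gamma> 0) - 0" using I0 r by metis
  then show "\<phi> r (\<gamma> 0) = \<gamma> r"
    using 1 phi[of r "fst (\<gamma> 0)" "snd (\<gamma> 0)"] by (simp add: prod_eq_iff)
qed

theorem corollary3:
  fixes \<A> \<F> :: "('m::{t2_space,second_countable_topology}, 'e::euclidean_space \<times> real) chart set"
    and N :: "('m, 'e \<times> real) vfield"
    and T :: "real set"
    and f :: "nat \<Rightarrow> real \<Rightarrow> 'm \<Rightarrow> real"
    and C :: real
    and g :: "real \<Rightarrow> ('m, 'e \<times> real) metric_field"
    and \<Gamma> :: "real \<Rightarrow> ('m, 'e \<times> real) conn"
    and \<tau> :: "nat \<Rightarrow> 'm \<times> real \<Rightarrow> real"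
    and \<psi> :: "real \<Rightarrow> 'm \<Rightarrow> 'm"
    and \<phi> :: "real \<Rightarrow> 'm \<times> real \<Rightarrow> 'm \<times> real"
  assumes dim_leaves: "DIM('e) \<ge> 2"
    and manifold: "smooth_atlas \<A>"
    and foliation: "transversely_oriented_foliation \<A> \<F>"
    and egf: "extrinsic_geometric_flow \<A> \<F> N T f g \<Gamma>"
    and f_1: "\<And>t p. t \<in> T \<Longrightarrow> f 1 t p = C"
    and f_other: "\<And>j t p. j < DIM('e) \<Longrightarrow> j \<noteq> 1 \<Longrightarrow> t \<in> T \<Longrightarrow> f j t p = 0"
    and tau: "\<And>i p t. \<tau> i (p, t) = power_sum \<A> \<F> (g t) (\<Gamma> t) N i p"
    and psi: "is_flow \<A> (scale_field (C / 2) N) \<psi>"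
    and phi: "\<And>r p s. \<phi> r (p, s) = (\<psi> r p, r + s)"
  shows "is_flow (time_atlas \<A>) (time_plus_field (scale_field (C / 2) N)) \<phi> \<and>
    (\<forall>i. \<forall>t\<in>T. \<forall>p. (- t, p) \<in> flow_domain \<A> (scale_field (C / 2) N) \<longrightarrow>
       \<tau> i (p, t) = \<tau> i (\<phi> (- t) (p, t)) \<and> \<tau> i (p, t) = \<tau> i (\<psi> (- t) p, 0)) \<and>
    (\<forall>i. (\<exists>a. \<forall>p. \<tau> i (p, 0) = a) \<longrightarrow>
       (\<forall>t\<in>T. (\<forall>p. (- t, p) \<in> flow_domain \<A> (scale_field (C / 2) N)) \<longrightarrow>
          (\<exists>a. \<forall>p. \<tau> i (p, t) = a)))"
proof -
  have T: "is_interval T" "0 \<in> T" and smooth: "smooth_metric_family \<A> T g"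
    and lc: "\<And>t. t \<in> T \<Longrightarrow> levi_civita \<A> (g t) (\<Gamma> t)"
    and normal: "\<And>t. t \<in> T \<Longrightarrow> oriented_unit_normal \<A> \<F> (g t) N"
    and evolution: "\<And>t c p u v. t \<in> T \<Longrightarrow> c \<in> \<A> \<Longrightarrow> p \<in> cdom c \<Longrightarrow>
        ((\<lambda>s. g s c p u v) has_real_derivative
           (\<Sum>j<DIM('e). f j t p * b_hat (g t) (\<Gamma> t) N j c p u v)) (at t within T)"
    using egf unfolding extrinsic_geometric_flow_def by blast+
  have flow: "((\<lambda>s. g s c p u v) has_real_derivative C * b_hat (g t) (\<Gamma> t) N (Suc 0) c p u v) (at t within T)"
    if "t \<in> T" "c \<in> \<A>" "p \<in> cdom c" for t c p u v
  proof -
    \<comment> \<open>The index 1 is in the range of summation because the leaves have dimension at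
      least 2.\<close>
    have "(\<Sum>j<DIM('e). f j t p * b_hat (g t) (\<Gamma> t) N j c p u v) =
        (\<Sum>j\<in>{1}. f j t p * b_hat (g t) (\<Gamma> t) N j c p u v)"
      by (rule sum.mono_neutral_right) (use dim_leaves f_other[OF _ _ that(1)] in auto)
    then show ?thesis using evolution[OF that, of u v] f_1[OF that(1), of p] by simp
  qed
  have unit_field: "unit_field_manifold \<A> (g t) (\<Gamma> t) N" if t: "t \<in> T" for t
  proof
    show "riemannian_metric \<A> (g t)" using smooth t by (simp add: smooth_metric_family_def)
    show "vector_field \<A> N" using normal[OF t] by (simp add: oriented_unit_normal_def)
    show "g t c p (N c p) (N c p) = 1" if "c \<in> \<A>" "p \<in> cdom c" for c p
      using normal[OF t] that unfolding oriented_unit_normal_def by blast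
  qed (rule manifold, rule lc[OF t])
  have foliated: "foliated_manifold \<A> (g t) (\<Gamma> t) N \<F>" if t: "t \<in> T" for t
    by (intro foliated_manifold.intro foliated_manifold_axioms.intro unit_field[OF t] foliation normal[OF t])
  have transport: "\<tau> i (p, t) = \<tau> i (\<psi> (- t) p, 0)"
    if t: "t \<in> T" and dom: "(- t, p) \<in> flow_domain \<A> (scale_field (C / 2) N)" for i t p
  proof -
    obtain I \<gamma> where curve: "integral_curve \<A> (scale_field (C / 2) N) I \<gamma>"
      and I: "0 \<in> I" "- t \<in> I" and \<gamma>0: "\<gamma> 0 = p"
      using dom by (auto simp: flow_domain_def)
    have \<psi>: "\<psi> (- t) p = \<gamma> (- t)" using psi curve I \<gamma>0 unfolding is_flow_def by blast
    consider "C = 0" | "t = 0" | "C \<noteq> 0" "t \<noteq> 0" by blast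
    then show ?thesis
    proof cases
      case 1
      \<comment> \<open>For \<open>C = 0\<close> the second form cannot be recovered from the time
        derivative of the metric. Here the flow fixes every point and the metric does not
        change.\<close>
      have "integral_curve \<A> (scale_field (C / 2) N) UNIV (\<lambda>_. p)"
        using 1 by (simp add: integral_curve_def scale_field_def)
      then have "\<psi> (- t) p = p" using psi unfolding is_flow_def by blast
      moreover have "g t c q u v = g 0 c q u v" if "c \<in> \<A>" "q \<in> cdom c" for c q u v
      proof -
        have "\<exists>k. \<forall>s\<in>T. g s c q u v = k"
          using flow[OF _ that] T(1) 1 by (intro has_field_derivative_zero_constant is_interval_convex) auto
        then show ?thesis using t T(2) by auto
      qed
      then have "weingarten (g t) (\<Gamma> t) N (chart_around \<A> p) p = weingarten (g 0) (\<Gamma> 0) N (chart_around \<A> p) p"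
        using unit_field_manifold.chart_around[OF unit_field[OF t], of p]
        by (intro unit_field_manifold_cong_metric[OF unit_field[OF t] unit_field[OF T(2)]]) auto
      then have "power_sum \<A> \<F> (g t) (\<Gamma> t) N i p = power_sum \<A> \<F> (g 0) (\<Gamma> 0) N i p"
        by (rule power_sum_cong_weingarten)
      ultimately show ?thesis by (simp add: tau)
    next
      case 2
      then show ?thesis using \<psi> \<gamma>0 by simp
    next
      case 3
      \<comment> \<open>The interval between 0 and \<open>t\<close>, in either order; it is
        nondegenerate since \<open>t\<close> is not 0.\<close>
      define a b where "a = min 0 t" and "b = max 0 t"
      have ab: "{a..b} \<subseteq> T"
        using mem_is_interval_1_I[OF T(1,2) t] mem_is_interval_1_I[OF T(1) t T(2)]
        by (auto simp: a_def b_def min_def max_def split: if_splits)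
      interpret unit_field_flow \<A> g \<Gamma> N C a b
      proof (rule unit_field_flow.intro)
        show "unit_field_manifold \<A> (g t) (\<Gamma> t) N" if "t \<in> {a..b}" for t
          using unit_field that ab by blast
        show "a < b" using 3 by (simp add: a_def b_def)
        show "smooth_on ({a..b} \<times> coord c ` cdom c) (\<lambda>(t, x). g t c (chart_inv c x) u v)" if "c \<in> \<A>" for c u v
        proof (rule smooth_on_subset)
          show "smooth_on (T \<times> coord c ` cdom c) (\<lambda>(t, x). g t c (chart_inv c x) u v)"
            using smooth that unfolding smooth_metric_family_def by blast
        qed (use ab in blast)
        show "((\<lambda>s. g s c p u v) has_real_derivative C * b_hat (g t) (\<Gamma> t) N (Suc 0) c p u v) (at t within {a..b})"
          if "t \<in> {a..b}" "c \<in> \<A>" "p \<in> cdom c" for t c p u v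
          using flow[of t c p u v] that ab DERIV_subset by blast
      qed (rule 3(1))
      have \<tau>: "\<tau> i (p, s) = spectrum_sum i s (chart_around \<A> p) p" if "s \<in> T" for s p
        using foliated_manifold.power_sum_eq[OF foliated[OF that]] by (simp add: tau spectrum_sum_def)
      \<comment> \<open>For \<open>s\<close> between 0 and \<open>t\<close> the parameter
        \<open>s - t\<close> lies between \<open>- t\<close> and 0, both of which belong to the
        interval \<open>I\<close>.\<close>
      have "s - t \<in> I" if "s \<in> {a..b}" for s
      proof -
        have "is_interval I" using curve by (simp add: integral_curve_def)
        from mem_is_interval_1_I[OF this I(1,2)] mem_is_interval_1_I[OF this I(2,1)] that
        show ?thesis by (auto simp: a_def b_def min_def max_def split: if_splits)
      qed
      \<comment> \<open>With shift \<open>t\<close>, the curve is at \<open>p\<close> at time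
        \<open>t\<close> and at \<open>\<psi> (- t) p\<close> at time 0.\<close>
      from spectrum_sum_constant[OF curve this, of t 0 i]
      show ?thesis by (simp add: \<tau>[OF t] \<tau>[OF T(2)] \<psi> \<gamma>0 a_def b_def)
    qed
  qed
  have "(\<Union>c\<in>\<A>. cdom c) = UNIV" using manifold by (simp add: smooth_atlas_def)
  \<comment> \<open>The flow \<open>\<phi>\<close> for time \<open>- t\<close> takes
    \<open>(p, t)\<close> to the slice at time 0, so both forms of the claim are the transport
    identity; an initial value that is constant is then found at every \<open>p\<close>.\<close>
  from is_flow_time_plus_field[OF this psi phi] transport show ?thesis
    by (auto simp: phi)
qed

end
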